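(* Let $G=(\mathbb{V},\mathbb{E})$ be a connected, undirected, locally finite quasi-transitive graph. Suppose $\Gamma\le\mathrm{Aut}(G)$ and the action of $\Gamma$ on $G$ has finitely many orbits. Let $V:\mathbb{V}\to\mathbb{R}$ satisfy $\inf_{x\in\mathbb{V}}V(x)>-1$, and fix $x_0\in\mathbb{V}$. Assume that one of the following holds: (a) $V$ is $\Gamma$-invariant; (b) there exists a $\Gamma$-invariant function $V_p:\mathbb{V}\to\mathbb{R}$ such that $V(x)\le V_p(x)$ for all $x\in\mathbb{V}$ and $|V(x)-V_p(x)|\to0$ as $d(x,x_0)\to+\infty$; (c) $\sup_{x\in\mathbb{V}}V(x)=V_\infty<\infty$ with $V_\infty=\lim_{d(x,x_0)\to\infty}V(x)$. Then the equation $$-\Delta u+V(x)u=u\log u^2,\quad x\in\mathbb{V},$$ has a ground state solution $u$. Moreover, $u(x)>0$ for all $x\in\mathbb{V}$ or $u(x)<0$ for all $x\in\mathbb{V}$.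
   Context: $\mathrm{Aut}(G)$ is the group of automorphisms of $G$; $G$ is quasi-transitive if the action of $\mathrm{Aut}(G)$ on $G$ has finitely many orbits. A function $g$ on $\mathbb{V}$ is $\Gamma$-invariant if $g(\gamma x)=g(x)$ for all $\gamma\in\Gamma$, $x\in\mathbb{V}$. $x\sim y$ means $xy\in\mathbb{E}$; $d$ is the graph distance. All functions are real valued, edge weights are $1$, $\mu$ is the counting measure, $\int_{\mathbb{V}}f\,d\mu=\sum_{x\in\mathbb{V}}f(x)$, $\Delta u(x)=\sum_{y\sim x}(u(y)-u(x))$, $|\nabla u|^2(x)=\frac12\sum_{y\sim x}(u(y)-u(x))^2$. $H^1(\mathbb{V})$ is the completion of the finitely supported functions under $\left(\int_{\mathbb{V}}(|\nabla u|^2+u^2)d\mu\right)^{1/2}$, and $X=\{u\in H^1(\mathbb{V}):\int_{\mathbb{V}}(V+1)u^2\,d\mu<\infty\}$. The energy $J:X\to(-\infty,+\infty]$ is $$J(u)=\frac12\int_{\mathbb{V}}\left(|\nabla u|^2+(V(x)+1)u^2\right)d\mu-\frac12\int_{\mathbb{V}}u^2\log u^2\,d\mu$$ with $0\log 0=0$; $D(J)=\{u\in X:J(u)<+\infty\}$. The Nehari manifold is $$\mathcal{N}=\left\{u\in D(J)\setminus\{0\}:\int_{\mathbb{V}}(|\nabla u|^2+V u^2)\,d\mu=\int_{\mathbb{V}}u^2\log u^2\,d\mu\right\}.$$ A solution is $u\in D(J)$ satisfying the equation at every vertex; a ground state solution is a nontrivial solution $u$ with $J(u)=\inf_{\mathcal{N}}J$.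 *)

theory Defs
  imports "HOL-Analysis.Analysis" "HOL-Algebra.Group_Action"
begin

text \<open>
  A graph is given by its adjacency relation \<open>E\<close> on a vertex type \<open>'a\<close>; the vertex set is the
  whole type. Undirectedness is symmetry of \<open>E\<close>. Loops are not excluded: they contribute nothing
  to the Laplacian, the gradient or the distance.
\<close>

definition connected_graph :: "('a \<Rightarrow> 'a \<Rightarrow> bool) \<Rightarrow> bool" where
  "connected_graph E \<longleftrightarrow> (\<forall>x y. E\<^sup>*\<^sup>* x y)"

definition locally_finite_graph :: "('a \<Rightarrow> 'a \<Rightarrow> bool) \<Rightarrow> bool" where
  "locally_finite_graph E \<longleftrightarrow> (\<forall>x. finite {y. E x y})"

text \<open>Only meaningful for vertices joined by a path, hence on connected graphs.\<close>

definition graph_dist :: "('a \<Rightarrow> 'a \<Rightarrow> bool) \<Rightarrow> 'a \<Rightarrow> 'a \<Rightarrow> nat" where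
  "graph_dist E x y = (LEAST n. (E ^^ n) x y)"

text \<open>
  The filter of \<open>d(x, x\<^sub>0) \<rightarrow> \<infinity>\<close>. It is trivial when distances to \<open>x\<^sub>0\<close> are bounded
  (finite graphs), so that limits along it then hold vacuously.
\<close>

definition at_graph_infinity :: "('a \<Rightarrow> 'a \<Rightarrow> bool) \<Rightarrow> 'a \<Rightarrow> 'a filter" where
  "at_graph_infinity E x0 = filtercomap (\<lambda>x. graph_dist E x x0) at_top"

definition Aut :: "('a \<Rightarrow> 'a \<Rightarrow> bool) \<Rightarrow> ('a \<Rightarrow> 'a) monoid" where
  "Aut E = (BijGroup UNIV)
     \<lparr>carrier := {f \<in> Bij UNIV. \<forall>x y. E (f x) (f y) \<longleftrightarrow> E x y}\<rparr>"

definition finitely_many_orbits :: "('a \<Rightarrow> 'a \<Rightarrow> bool) \<Rightarrow> ('a \<Rightarrow> 'a) set \<Rightarrow> bool" where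
  "finitely_many_orbits E \<Gamma> \<longleftrightarrow> finite (orbits (Aut E\<lparr>carrier := \<Gamma>\<rparr>) UNIV (\<lambda>\<gamma>. \<gamma>))"

definition quasi_transitive :: "('a \<Rightarrow> 'a \<Rightarrow> bool) \<Rightarrow> bool" where
  "quasi_transitive E \<longleftrightarrow> finitely_many_orbits E (carrier (Aut E))"

definition invariant_under :: "('a \<Rightarrow> 'a) set \<Rightarrow> ('a \<Rightarrow> real) \<Rightarrow> bool" where
  "invariant_under \<Gamma> g \<longleftrightarrow> (\<forall>\<gamma>\<in>\<Gamma>. \<forall>x. g (\<gamma> x) = g x)"

definition laplacian :: "('a \<Rightarrow> 'a \<Rightarrow> bool) \<Rightarrow> ('a \<Rightarrow> real) \<Rightarrow> 'a \<Rightarrow> real" where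
  "laplacian E u x = (\<Sum>y | E x y. u y - u x)"

definition grad_sq :: "('a \<Rightarrow> 'a \<Rightarrow> bool) \<Rightarrow> ('a \<Rightarrow> real) \<Rightarrow> 'a \<Rightarrow> real" where
  "grad_sq E u x = 1/2 * (\<Sum>y | E x y. (u y - u x)\<^sup>2)"

text \<open>
  The extended-real integral against the counting measure, as integral of the positive part minus
  integral of the negative part (\<open>ennreal\<close> truncates negative reals to 0). It is the expected value
  whenever one of the two is finite; in \<open>energy\<close> and \<open>nehari\<close> below this is always so on the
  domains where they are used, since functions in \<open>H1\<close> are square-summable.
\<close>

definition vint :: "('a \<Rightarrow> real) \<Rightarrow> ereal" where
  "vint f = enn2ereal (\<integral>\<^sup>+x. ennreal (f x) \<partial>count_space UNIV)
          - enn2ereal (\<integral>\<^sup>+x. ennreal (- f x) \<partial>count_space UNIV)"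

definition H1_norm :: "('a \<Rightarrow> 'a \<Rightarrow> bool) \<Rightarrow> ('a \<Rightarrow> real) \<Rightarrow> real" where
  "H1_norm E u = sqrt (\<integral>x. grad_sq E u x + (u x)\<^sup>2 \<partial>count_space UNIV)"

text \<open>
  The completion of the finitely supported functions, realised as a space of functions: since the
  norm dominates the \<open>\<ell>\<^sup>2\<close> norm, Cauchy sequences converge pointwise and the completion is the
  closure of the finitely supported functions among the functions of finite norm. Finiteness of the
  norm is required explicitly because the Bochner integral of a non-integrable function is 0.
\<close>

definition H1 :: "('a \<Rightarrow> 'a \<Rightarrow> bool) \<Rightarrow> ('a \<Rightarrow> real) set" where
  "H1 E = {u. integrable (count_space UNIV) (\<lambda>x. grad_sq E u x + (u x)\<^sup>2) \<and>
     (\<exists>\<phi> :: nat \<Rightarrow> 'a \<Rightarrow> real. (\<forall>n. finite {x. \<phi> n x \<noteq> 0}) \<and>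
        (\<lambda>n. H1_norm E (\<lambda>x. \<phi> n x - u x)) \<longlonglongrightarrow> 0)}"

definition X_space :: "('a \<Rightarrow> 'a \<Rightarrow> bool) \<Rightarrow> ('a \<Rightarrow> real) \<Rightarrow> ('a \<Rightarrow> real) set" where
  "X_space E V = {u \<in> H1 E. vint (\<lambda>x. (V x + 1) * (u x)\<^sup>2) < \<infinity>}"

text \<open>The convention \<open>0 log 0 = 0\<close> is automatic.\<close>

definition energy :: "('a \<Rightarrow> 'a \<Rightarrow> bool) \<Rightarrow> ('a \<Rightarrow> real) \<Rightarrow> ('a \<Rightarrow> real) \<Rightarrow> ereal" where
  "energy E V u =
     ereal (1/2) * vint (\<lambda>x. grad_sq E u x + (V x + 1) * (u x)\<^sup>2)
   - ereal (1/2) * vint (\<lambda>x. (u x)\<^sup>2 * ln ((u x)\<^sup>2))"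

definition energy_domain :: "('a \<Rightarrow> 'a \<Rightarrow> bool) \<Rightarrow> ('a \<Rightarrow> real) \<Rightarrow> ('a \<Rightarrow> real) set" where
  "energy_domain E V = {u \<in> X_space E V. energy E V u < \<infinity>}"

definition nehari :: "('a \<Rightarrow> 'a \<Rightarrow> bool) \<Rightarrow> ('a \<Rightarrow> real) \<Rightarrow> ('a \<Rightarrow> real) set" where
  "nehari E V = {u \<in> energy_domain E V - {\<lambda>x. 0}.
     vint (\<lambda>x. grad_sq E u x + V x * (u x)\<^sup>2) = vint (\<lambda>x. (u x)\<^sup>2 * ln ((u x)\<^sup>2))}"

definition solution :: "('a \<Rightarrow> 'a \<Rightarrow> bool) \<Rightarrow> ('a \<Rightarrow> real) \<Rightarrow> ('a \<Rightarrow> real) \<Rightarrow> bool" where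
  "solution E V u \<longleftrightarrow> u \<in> energy_domain E V \<and>
     (\<forall>x. - laplacian E u x + V x * u x = u x * ln ((u x)\<^sup>2))"

definition ground_state_solution :: "('a \<Rightarrow> 'a \<Rightarrow> bool) \<Rightarrow> ('a \<Rightarrow> real) \<Rightarrow> ('a \<Rightarrow> real) \<Rightarrow> bool" where
  "ground_state_solution E V u \<longleftrightarrow> solution E V u \<and> u \<noteq> (\<lambda>x. 0) \<and>
     energy E V u = (INF v\<in>nehari E V. energy E V v)"

end

theory Submission
  imports Defs "HOL-Complex_Analysis.Great_Picard" "HOL-Real_Asymp.Real_Asymp"
begin

text \<open>
  In each of the three cases \<open>V\<close> is bounded and lies below a \<open>\<Gamma>\<close>-invariant potential \<open>W\<close> to which it
  is asymptotic: \<open>W = V\<close> in case (a), \<open>W = V\<^sub>p\<close> in case (b), and \<open>W\<close> is the constant \<open>V_inf\<close> in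
  case (c). Degrees are bounded too, so \<open>H\<^sup>1\<close> is just \<open>\<ell>\<^sup>2\<close>, and the domain of the energy consists of
  the \<open>u \<in> \<ell>\<^sup>2\<close> for which \<open>u\<^sup>2 ln u\<^sup>2\<close> is summable.

  Write \<open>Q(u) = \<Sum> |\<nabla>u|\<^sup>2 + V u\<^sup>2 - u\<^sup>2 ln u\<^sup>2\<close> (called \<open>action\<close>) and \<open>m(u) = \<Sum> u\<^sup>2\<close> (called \<open>mass\<close>). Then
  \<open>J = (Q + m) / 2\<close>, and the Nehari manifold is \<open>Q = 0\<close>, \<open>u \<noteq> 0\<close>. Since
  \<open>Q(s u) = s\<^sup>2 (Q(u) - ln s\<^sup>2 m(u))\<close>, each ray meets the Nehari manifold exactly once, and minimising
  \<open>J\<close> there amounts to minimising \<open>Q\<close> on the unit sphere \<open>m = 1\<close>. If \<open>c\<close> is the infimum on the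
  sphere, the scaling law gives the logarithmic Sobolev inequality \<open>Q(w) \<ge> c m(w) - m(w) ln m(w)\<close> for
  all \<open>w\<close> (lemma \<open>log_sobolev\<close>), and a minimiser \<open>u\<close> of \<open>Q\<close> gives the ground state \<open>exp (c/2) u\<close>
  (lemma \<open>ground_state_of_minimizer\<close>).

  Compactness comes from the strict subadditivity of \<open>m \<mapsto> c m - m ln m\<close>. Let a minimising sequence
  converge pointwise to \<open>v \<noteq> 0\<close>. Cutting sharply at a large finite ball splits \<open>Q\<close> exactly, up to an
  interaction across the boundary of the ball that is small because \<open>v \<in> \<ell>\<^sup>2\<close>; if mass escaped to
  infinity, the two pieces would together cost strictly more than \<open>c\<close>. Hence \<open>v\<close> is a minimiser (lemma
  \<open>minimizing_limit\<close>).

  It remains to arrange \<open>v \<noteq> 0\<close>. On the sphere the entropy \<open>- \<Sum> u\<^sup>2 ln u\<^sup>2\<close> is at least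
  \<open>- ln (max u\<^sup>2)\<close>, so that bounded action keeps \<open>max u\<^sup>2\<close> away from zero; for the invariant potential
  \<open>W\<close> the maximum can be moved into a finite set of representatives of the orbits (lemma
  \<open>minimizer_if_cocompact\<close>). If \<open>V < W\<close> somewhere, then testing with a positive minimiser for \<open>W\<close> shows that
  the infimum for \<open>V\<close> is strictly smaller than the one for \<open>W\<close>; a sequence vanishing pointwise would
  not feel the difference between \<open>V\<close> and \<open>W\<close>, which contradicts this (lemma \<open>minimizer_if_below\<close>).

  Finally \<open>|u|\<close> minimises whenever \<open>u\<close> does. As \<open>t\<^sup>2 ln t\<^sup>2\<close> is differentiable even at \<open>0\<close>, the
  Euler-Lagrange equation holds at zeros of \<open>|u|\<close> as well, where it forces all neighbouring values to
  vanish; by connectedness \<open>|u|\<close> has no zeros.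
\<close>

section \<open>Sums over the vertex set\<close>

abbreviation vsummable :: "('a \<Rightarrow> real) \<Rightarrow> bool" where
  "vsummable f \<equiv> integrable (count_space UNIV) f"

abbreviation vsum :: "('a \<Rightarrow> real) \<Rightarrow> real" where
  "vsum f \<equiv> integral\<^sup>L (count_space UNIV) f"

lemma vsummable_bound:
  fixes f g :: "'a \<Rightarrow> real"
  assumes "vsummable g" "\<And>x. \<bar>f x\<bar> \<le> g x"
  shows "vsummable f"
  by (rule Bochner_Integration.integrable_bound[OF assms(1)])
    (auto intro: order_trans[OF assms(2) abs_ge_self])

lemma
  fixes f :: "'a \<Rightarrow> real"
  assumes "finite S" "\<And>x. x \<notin> S \<Longrightarrow> f x = 0"
  shows vsummable_finite_support: "vsummable f"
    and vsum_finite_support: "vsum f = sum f S"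
proof -
  have "(\<integral>\<^sup>+x. ennreal (norm (f x)) \<partial>count_space UNIV) = (\<Sum>x\<in>S. ennreal (norm (f x)))"
    using assms by (intro nn_integral_count_space') auto
  then show "vsummable f"
    by (auto simp: integrable_iff_bounded assms(1))
  have "finite {x. f x \<noteq> 0}"
    using assms by (auto intro: finite_subset[OF _ assms(1)])
  then have "vsum f = sum f {x. f x \<noteq> 0}"
    using lebesgue_integral_count_space_finite_support[of UNIV f] by simp
  also have "\<dots> = sum f S"
    using assms by (intro sum.mono_neutral_left) auto
  finally show "vsum f = sum f S" .
qed

lemma
  fixes f g :: "'a \<Rightarrow> real"
  assumes "\<And>y. y \<noteq> x \<Longrightarrow> g y = f y" "vsummable f"
  shows vsummable_update: "vsummable g"
    and vsum_update: "vsum g = vsum f + (g x - f x)"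
proof -
  define h where "h = (\<lambda>y. g y - f y)"
  have h: "vsummable h" "vsum h = g x - f x"
    using vsummable_finite_support[of "{x}" h] vsum_finite_support[of "{x}" h] assms(1)
    by (auto simp: h_def)
  have "g = (\<lambda>y. f y + h y)"
    by (auto simp: h_def)
  then show "vsummable g" "vsum g = vsum f + (g x - f x)"
    using h assms(2) by auto
qed

lemma sum_le_vsum:
  fixes f :: "'a \<Rightarrow> real"
  assumes "finite S" "vsummable f" "\<And>x. 0 \<le> f x"
  shows "sum f S \<le> vsum f"
proof -
  let ?g = "\<lambda>x. if x \<in> S then f x else 0"
  have "vsummable ?g" "vsum ?g = sum f S"
    using vsummable_finite_support[of S ?g] vsum_finite_support[of S ?g] assms(1) by auto
  then have "sum f S = vsum ?g" by simp
  also have "\<dots> \<le> vsum f"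
    using \<open>vsummable ?g\<close> assms by (intro integral_mono) auto
  finally show ?thesis .
qed

lemma vsum_tendsto_dominated:
  fixes f :: "nat \<Rightarrow> 'a \<Rightarrow> real"
  assumes "vsummable g" "\<And>n x. \<bar>f n x\<bar> \<le> g x" "\<And>x. (\<lambda>n. f n x) \<longlonglongrightarrow> h x"
  shows "(\<lambda>n. vsum (f n)) \<longlonglongrightarrow> vsum h"
  by (rule integral_dominated_convergence[where w = g]) (use assms in auto)

lemma vsum_tendsto_finite_support:
  fixes f :: "nat \<Rightarrow> 'a \<Rightarrow> real"
  assumes "finite S" "\<And>n x. x \<notin> S \<Longrightarrow> f n x = 0" "\<And>x. (\<lambda>n. f n x) \<longlonglongrightarrow> h x"
  shows "(\<lambda>n. vsum (f n)) \<longlonglongrightarrow> vsum h"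
proof -
  have "h x = 0" if "x \<notin> S" for x
    using assms(2)[OF that] assms(3)[of x] LIMSEQ_unique[OF tendsto_const] by fastforce
  then have "vsum h = sum h S" "\<And>n. vsum (f n) = sum (f n) S"
    using assms(1,2) by (auto intro: vsum_finite_support)
  then show ?thesis
    using assms(3) by (auto intro: tendsto_sum)
qed

definition exhaustion :: "(nat \<Rightarrow> 'a set) \<Rightarrow> bool" where
  "exhaustion B \<longleftrightarrow> (\<forall>k. finite (B k)) \<and> incseq B \<and> (\<Union>k. B k) = UNIV"

lemma exhaustion_eventually:
  assumes "exhaustion B" shows "eventually (\<lambda>k. x \<in> B k) sequentially"
proof -
  have "x \<in> (\<Union>k. B k)" using assms by (simp add: exhaustion_def)
  then obtain k where "x \<in> B k" by blast
  then show ?thesis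
    using assms unfolding eventually_sequentially exhaustion_def incseq_def by blast
qed

lemma
  fixes f :: "'a \<Rightarrow> real"
  assumes B: "exhaustion B" and nonneg: "\<And>x. 0 \<le> f x" and bound: "\<And>k. sum f (B k) \<le> C"
  shows vsummable_bounded_sums: "vsummable f" and vsum_le_bounded_sums: "vsum f \<le> C"
proof -
  define g where "g = (\<lambda>k x. if x \<in> B k then f x else 0)"
  have B': "finite (B k)" "mono B" for k
    using B by (auto simp: exhaustion_def)
  have g: "vsummable (g k)" "vsum (g k) = sum f (B k)" for k
    using vsummable_finite_support[of "B k" "g k"] vsum_finite_support[of "B k" "g k"] B'
    by (auto simp: g_def)
  have "incseq (\<lambda>k. vsum (g k))"
    unfolding g incseq_def using B' nonneg by (auto intro!: sum_mono2 dest: monoD)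
  then obtain L where L: "(\<lambda>k. vsum (g k)) \<longlonglongrightarrow> L"
    using bound g(2) by (metis incseq_convergent)
  have mono: "mono (\<lambda>n. g n x)" for x
    using B' nonneg by (auto simp: g_def mono_def)
  have lim: "(\<lambda>n. g n x) \<longlonglongrightarrow> f x" for x
    by (rule tendsto_eventually, rule eventually_mono[OF exhaustion_eventually[OF B, of x]])
      (simp add: g_def)
  note thms = integral_monotone_convergence[of "count_space UNIV" g f L]
    integrable_monotone_convergence[of "count_space UNIV" g f L]
  show "vsummable f" by (rule thms(2)) (use g mono lim L in auto)
  have "vsum f = L" by (rule thms(1)) (use g mono lim L in auto)
  then show "vsum f \<le> C"
    using LIMSEQ_le_const2[OF L] bound g(2) by auto
qed

section \<open>The function \<open>t\<^sup>2 ln t\<^sup>2\<close>\<close>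

definition square_log :: "real \<Rightarrow> real" where
  "square_log t = t\<^sup>2 * ln (t\<^sup>2)"

lemma square_log_simps [simp]:
  "square_log 0 = 0" "square_log \<bar>t\<bar> = square_log t"
  by (simp_all add: square_log_def)

lemma square_log_mult:
  assumes "s \<noteq> 0"
  shows "square_log (s * t) = s\<^sup>2 * square_log t + s\<^sup>2 * ln (s\<^sup>2) * t\<^sup>2"
  using assms by (cases "t = 0") (auto simp: square_log_def power_mult_distrib ln_mult algebra_simps)

lemma square_log_nonpos:
  assumes "t\<^sup>2 \<le> 1" shows "square_log t \<le> 0"
proof (cases "t = 0")
  case False
  then have "ln (t\<^sup>2) \<le> 0" using assms by simp
  then show ?thesis unfolding square_log_def by (simp add: mult_nonneg_nonpos)
qed auto

text \<open>
  At \<open>t = 0\<close> the difference quotient is \<open>h ln h\<^sup>2\<close>, which tends to \<open>0\<close>. Differentiability there is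
  what makes the Euler-Lagrange equation available at zeros of a minimiser.
\<close>

lemma DERIV_square_log: "(square_log has_real_derivative 2 * t * ln (t\<^sup>2) + 2 * t) (at t)"
proof (cases "t = 0")
  case True
  have "((\<lambda>h::real. h * ln (h\<^sup>2)) \<longlongrightarrow> 0) (at 0)"
    unfolding filterlim_at_split by (intro conjI; real_asymp)
  moreover have "(square_log h - square_log 0) / h = h * ln (h\<^sup>2)" for h
    by (simp add: square_log_def power2_eq_square)
  ultimately show ?thesis
    using True by (simp add: DERIV_def)
next
  case False
  show ?thesis
    unfolding square_log_def using False
    by (auto intro!: derivative_eq_intros simp: field_simps power2_eq_square zero_less_mult_iff)
qed

lemma tendsto_square_log [tendsto_intros]:
  assumes "(f \<longlongrightarrow> l) F" shows "((\<lambda>x. square_log (f x)) \<longlongrightarrow> square_log l) F"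
  by (rule isCont_tendsto_compose[OF DERIV_isCont[OF DERIV_square_log] assms])

lemma tendsto_x_ln_x:
  fixes f :: "'b \<Rightarrow> real"
  assumes "(f \<longlongrightarrow> l) F" "\<And>x. 0 \<le> f x" "0 \<le> l"
  shows "((\<lambda>x. f x * ln (f x)) \<longlongrightarrow> l * ln l) F"
proof -
  have "((\<lambda>x. square_log (sqrt (f x))) \<longlongrightarrow> square_log (sqrt l)) F"
    by (intro tendsto_intros assms)
  then show ?thesis using assms(2,3) by (simp add: square_log_def)
qed

section \<open>The constrained variational problem\<close>

definition log_domain :: "('a \<Rightarrow> real) set" where
  "log_domain = {u. vsummable (\<lambda>x. (u x)\<^sup>2) \<and> vsummable (\<lambda>x. square_log (u x))}"

definition mass :: "('a \<Rightarrow> real) \<Rightarrow> real" where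
  "mass u = vsum (\<lambda>x. (u x)\<^sup>2)"

definition action_density ::
  "('a \<Rightarrow> 'a \<Rightarrow> bool) \<Rightarrow> ('a \<Rightarrow> real) \<Rightarrow> ('a \<Rightarrow> real) \<Rightarrow> 'a \<Rightarrow> real" where
  "action_density E V u x = grad_sq E u x + V x * (u x)\<^sup>2 - square_log (u x)"

definition action :: "('a \<Rightarrow> 'a \<Rightarrow> bool) \<Rightarrow> ('a \<Rightarrow> real) \<Rightarrow> ('a \<Rightarrow> real) \<Rightarrow> real" where
  "action E V u = vsum (action_density E V u)"

definition ground_level :: "('a \<Rightarrow> 'a \<Rightarrow> bool) \<Rightarrow> ('a \<Rightarrow> real) \<Rightarrow> real" where
  "ground_level E V = (INF u\<in>{u \<in> log_domain. mass u = 1}. action E V u)"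

definition minimizer :: "('a \<Rightarrow> 'a \<Rightarrow> bool) \<Rightarrow> ('a \<Rightarrow> real) \<Rightarrow> ('a \<Rightarrow> real) \<Rightarrow> bool" where
  "minimizer E V u \<longleftrightarrow> u \<in> log_domain \<and> mass u = 1 \<and> action E V u = ground_level E V"

definition cutoff :: "'a set \<Rightarrow> ('a \<Rightarrow> real) \<Rightarrow> 'a \<Rightarrow> real" where
  "cutoff S u x = (if x \<in> S then u x else 0)"

text \<open>
  The part of \<open>|\<nabla>(a + b)|\<^sup>2 - |\<nabla>a|\<^sup>2 - |\<nabla>b|\<^sup>2\<close> that survives when \<open>a\<close> and \<open>b\<close> have disjoint supports, with
  its sign reversed.
\<close>

definition cross :: "('a \<Rightarrow> 'a \<Rightarrow> bool) \<Rightarrow> ('a \<Rightarrow> real) \<Rightarrow> ('a \<Rightarrow> real) \<Rightarrow> 'a \<Rightarrow> real" where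
  "cross E a b x = (\<Sum>y | E x y. a x * b y + a y * b x)"

lemma cutoff_in_log_domain:
  assumes "u \<in> log_domain" shows "cutoff S u \<in> log_domain"
proof -
  have "vsummable (\<lambda>x. (cutoff S u x)\<^sup>2)"
    by (rule vsummable_bound[of "\<lambda>x. (u x)\<^sup>2"]) (use assms in \<open>auto simp: log_domain_def cutoff_def\<close>)
  moreover have "vsummable (\<lambda>x. square_log (cutoff S u x))"
    by (rule vsummable_bound[of "\<lambda>x. \<bar>square_log (u x)\<bar>"])
       (use assms in \<open>auto simp: log_domain_def cutoff_def\<close>)
  ultimately show ?thesis by (simp add: log_domain_def)
qed

lemma scale_in_log_domain:
  assumes "u \<in> log_domain" shows "(\<lambda>x. s * u x) \<in> log_domain"
proof (cases "s = 0")
  case False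
  then show ?thesis
    using assms by (auto simp: log_domain_def power_mult_distrib square_log_mult)
qed (simp add: log_domain_def)

lemma mass_scale: "mass (\<lambda>x. s * u x) = s\<^sup>2 * mass u"
  by (simp add: mass_def power_mult_distrib)

lemma mass_nonneg: "0 \<le> mass u"
  by (simp add: mass_def)

lemma power2_le_mass:
  assumes "vsummable (\<lambda>x. (u x)\<^sup>2)" shows "(u x)\<^sup>2 \<le> mass u"
  using sum_le_vsum[of "{x}" "\<lambda>x. (u x)\<^sup>2"] assms by (simp add: mass_def)

lemma mass_pos:
  assumes "vsummable (\<lambda>x. (u x)\<^sup>2)" "u x \<noteq> 0" shows "0 < mass u"
proof -
  have "0 < (u x)\<^sup>2" using assms(2) by simp
  with power2_le_mass[of u x, OF assms(1)] show ?thesis by linarith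
qed

lemma mass_cutoff:
  assumes "vsummable (\<lambda>x. (u x)\<^sup>2)"
  shows "mass u = mass (cutoff S u) + mass (cutoff (- S) u)"
proof -
  have "vsummable (\<lambda>x. (cutoff T u x)\<^sup>2)" for T
    by (rule vsummable_bound[OF assms]) (auto simp: cutoff_def)
  moreover have "(\<lambda>x. (u x)\<^sup>2) = (\<lambda>x. (cutoff S u x)\<^sup>2 + (cutoff (- S) u x)\<^sup>2)"
    by (auto simp: cutoff_def)
  ultimately show ?thesis by (simp add: mass_def)
qed

lemma grad_sq_nonneg: "0 \<le> grad_sq E u x"
  by (simp add: grad_sq_def sum_nonneg)

lemma grad_sq_scale: "grad_sq E (\<lambda>x. s * u x) x = s\<^sup>2 * grad_sq E u x"
proof -
  have "(s * u y - s * u x)\<^sup>2 = s\<^sup>2 * (u y - u x)\<^sup>2" for y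
    by (simp add: power2_eq_square algebra_simps)
  then show ?thesis by (simp add: grad_sq_def sum_distrib_left mult_ac)
qed

lemma grad_sq_abs_le: "grad_sq E (\<lambda>x. \<bar>u x\<bar>) x \<le> grad_sq E u x"
  unfolding grad_sq_def
  by (intro mult_left_mono sum_mono) (auto simp: abs_le_square_iff[symmetric])

section \<open>Graphs of bounded degree\<close>

locale bounded_degree_graph =
  fixes E :: "'a \<Rightarrow> 'a \<Rightarrow> bool" and x0 :: 'a and D :: nat
  assumes sym: "E x y \<Longrightarrow> E y x"
    and conn: "E\<^sup>*\<^sup>* x y"
    and fin: "finite {y. E x y}"
    and deg: "card {y. E x y} \<le> D"
begin

definition graph_ball :: "nat \<Rightarrow> 'a set" where
  "graph_ball k = {x. graph_dist E x x0 \<le> k}"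

lemma finite_walks: "finite {x. (E ^^ n) x y}"
proof (induction n arbitrary: y)
  case (Suc n)
  have "{x. (E ^^ Suc n) x y} = (\<Union>z\<in>{z. E y z}. {x. (E ^^ n) x z})"
    using sym by (auto simp: relcompp_apply)
  then show ?case using Suc fin by auto
qed auto

lemma exhaustion_graph_ball: "exhaustion graph_ball"
proof -
  have walk: "(E ^^ graph_dist E x x0) x x0" for x
  proof -
    obtain n where "(E ^^ n) x x0" using conn[of x x0] by (auto simp: rtranclp_power)
    then show ?thesis unfolding graph_dist_def by (rule LeastI)
  qed
  have "finite (graph_ball k)" for k
    by (rule finite_subset[of _ "\<Union>n\<in>{..k}. {x. (E ^^ n) x x0}"])
      (use walk finite_walks in \<open>auto simp: graph_ball_def\<close>)
  then show ?thesis
    by (auto simp: exhaustion_def graph_ball_def incseq_def)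
qed

lemma finite_graph_ball: "finite (graph_ball k)"
  using exhaustion_graph_ball by (simp add: exhaustion_def)

lemma countable_vertices: "countable (UNIV :: 'a set)"
proof -
  have "countable (\<Union>k. graph_ball k)"
    by (intro countable_UN) (auto intro: countable_finite finite_graph_ball)
  then show ?thesis using exhaustion_graph_ball by (simp add: exhaustion_def)
qed

text \<open>
  A summable majorant, independent of the cutoff, for the gradient terms of \<open>u\<close> and of all its
  restrictions, as needed for dominated convergence along growing balls.
\<close>

definition nbr_mass :: "('a \<Rightarrow> real) \<Rightarrow> 'a \<Rightarrow> real" where
  "nbr_mass u x = (\<Sum>y | E x y. (u x)\<^sup>2 + (u y)\<^sup>2)"

text \<open>
  By Tonelli and the symmetry of \<open>E\<close>, the total over all \<open>x\<close> is \<open>\<Sum>y. card {x. E y x} * f y\<close>.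
\<close>

lemma nbr_sum_summable:
  fixes f :: "'a \<Rightarrow> real"
  assumes f: "vsummable f" and nonneg: "\<And>x. 0 \<le> f x"
  shows "vsummable (\<lambda>x. \<Sum>y | E x y. f y)"
proof -
  let ?I = "\<lambda>x y. ennreal (f y) * indicator {y. E x y} y"
  have nn: "(\<integral>\<^sup>+y. ennreal (f y) \<partial>count_space UNIV) < \<infinity>"
    using f nonneg by (simp add: integrable_iff_bounded)
  have "(\<integral>\<^sup>+x. ennreal (norm (\<Sum>y | E x y. f y)) \<partial>count_space UNIV)
      = (\<integral>\<^sup>+x. (\<integral>\<^sup>+y. ?I x y \<partial>count_space UNIV) \<partial>count_space UNIV)"
  proof (intro nn_integral_cong)
    fix x
    have "(\<integral>\<^sup>+y. ?I x y \<partial>count_space UNIV) = (\<Sum>y | E x y. ?I x y)"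
      using fin by (intro nn_integral_count_space') auto
    also have "\<dots> = (\<Sum>y | E x y. ennreal (f y))"
      by (intro sum.cong) auto
    also have "\<dots> = ennreal (\<Sum>y | E x y. f y)"
      using nonneg by (intro sum_ennreal) auto
    finally show "ennreal (norm (\<Sum>y | E x y. f y)) = (\<integral>\<^sup>+y. ?I x y \<partial>count_space UNIV)"
      using nonneg by (simp add: sum_nonneg)
  qed
  also have "\<dots> = (\<integral>\<^sup>+y. (\<integral>\<^sup>+x. ?I x y \<partial>count_space UNIV) \<partial>count_space UNIV)"
    using nn_integral_fst_count_space[of "\<lambda>(x, y). ?I x y"]
      nn_integral_snd_count_space[of "\<lambda>(x, y). ?I x y"] by simp
  also have "\<dots> \<le> (\<integral>\<^sup>+y. of_nat D * ennreal (f y) \<partial>count_space UNIV)"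
  proof (intro nn_integral_mono)
    fix y
    have "(\<integral>\<^sup>+x. ?I x y \<partial>count_space UNIV) = (\<Sum>x | E y x. ?I x y)"
      using fin sym by (intro nn_integral_count_space') (auto simp: indicator_def)
    also have "\<dots> = (\<Sum>x | E y x. ennreal (f y))"
      using sym by (intro sum.cong) auto
    also have "\<dots> \<le> of_nat D * ennreal (f y)"
      using deg[of y] by (auto intro: mult_right_mono)
    finally show "(\<integral>\<^sup>+x. ?I x y \<partial>count_space UNIV) \<le> of_nat D * ennreal (f y)" .
  qed
  also have "\<dots> < \<infinity>"
    using nn by (simp add: nn_integral_cmult ennreal_mult_less_top of_nat_less_top)
  finally show ?thesis by (simp add: integrable_iff_bounded)
qed

lemma nbr_mass_summable:
  assumes "vsummable (\<lambda>x. (u x)\<^sup>2)" shows "vsummable (nbr_mass u)"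
proof -
  have "vsummable (\<lambda>x. real (card {y. E x y}) * (u x)\<^sup>2)"
    by (rule vsummable_bound[of "\<lambda>x. real D * (u x)\<^sup>2"])
      (use assms deg in \<open>auto simp: abs_mult intro!: mult_right_mono\<close>)
  then show ?thesis
    unfolding nbr_mass_def sum.distrib using nbr_sum_summable[OF assms] by simp
qed

lemma grad_sq_le_nbr_mass: "grad_sq E u x \<le> nbr_mass u x"
  unfolding grad_sq_def nbr_mass_def sum_distrib_left
proof (rule sum_mono)
  fix y
  have "(u y)\<^sup>2 + (u x)\<^sup>2 - 1/2 * (u y - u x)\<^sup>2 = 1/2 * (u y + u x)\<^sup>2"
    by (simp add: power2_eq_square algebra_simps)
  moreover have "0 \<le> 1/2 * (u y + u x)\<^sup>2" by simp
  ultimately show "1/2 * (u y - u x)\<^sup>2 \<le> (u x)\<^sup>2 + (u y)\<^sup>2" by linarith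
qed

lemma grad_sq_summable:
  assumes "vsummable (\<lambda>x. (u x)\<^sup>2)" shows "vsummable (grad_sq E u)"
  by (rule vsummable_bound[OF nbr_mass_summable[OF assms]])
    (simp add: grad_sq_nonneg grad_sq_le_nbr_mass)

lemma nbr_mass_cutoff_le: "nbr_mass (cutoff S u) x \<le> nbr_mass u x"
  unfolding nbr_mass_def cutoff_def by (intro sum_mono) auto

lemma cross_le_nbr_mass: "\<bar>cross E (cutoff S u) (cutoff (- S) u) x\<bar> \<le> nbr_mass u x"
proof -
  have ab: "\<bar>a * b\<bar> \<le> a\<^sup>2 + b\<^sup>2" for a b :: real
  proof -
    have "2 * (\<bar>a\<bar> * \<bar>b\<bar>) \<le> a\<^sup>2 + b\<^sup>2"
      using sum_squares_bound[of "\<bar>a\<bar>" "\<bar>b\<bar>"] by simp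
    moreover have "0 \<le> \<bar>a\<bar> * \<bar>b\<bar>" by simp
    ultimately show ?thesis unfolding abs_mult by linarith
  qed
  show ?thesis
    unfolding cross_def nbr_mass_def
    by (rule order_trans[OF sum_abs], rule sum_mono)
      (use ab in \<open>auto simp: cutoff_def mult.commute add.commute\<close>)
qed

text \<open>
  Pointwise the interaction vanishes as soon as the ball contains a vertex and all its neighbours.
\<close>

lemma cross_tendsto_0:
  assumes "vsummable (\<lambda>x. (u x)\<^sup>2)"
  shows "(\<lambda>k. vsum (cross E (cutoff (graph_ball k) u) (cutoff (- graph_ball k) u))) \<longlonglongrightarrow> 0"
proof -
  have "(\<lambda>k. cross E (cutoff (graph_ball k) u) (cutoff (- graph_ball k) u) x) \<longlonglongrightarrow> 0" for x
  proof (rule tendsto_eventually)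
    have "eventually (\<lambda>k. \<forall>y\<in>insert x {y. E x y}. y \<in> graph_ball k) sequentially"
      using exhaustion_eventually[OF exhaustion_graph_ball] fin
      by (subst eventually_ball_finite_distrib) auto
    then show "eventually (\<lambda>k. cross E (cutoff (graph_ball k) u) (cutoff (- graph_ball k) u) x = 0) sequentially"
      by (rule eventually_mono) (auto simp: cross_def cutoff_def)
  qed
  then show ?thesis
    using vsum_tendsto_dominated[OF nbr_mass_summable[OF assms] cross_le_nbr_mass, where h = "\<lambda>_. 0"]
    by simp
qed

lemma cutoff_ball_tendsto: "(\<lambda>k. cutoff (graph_ball k) u x) \<longlonglongrightarrow> u x"
  by (rule tendsto_eventually, rule eventually_mono[OF exhaustion_eventually[OF exhaustion_graph_ball, of x]])
    (simp add: cutoff_def)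

lemma tendsto_grad_sq:
  assumes "\<And>x. (\<lambda>n. f n x) \<longlonglongrightarrow> u x"
  shows "(\<lambda>n. grad_sq E (f n) x) \<longlonglongrightarrow> grad_sq E u x"
  unfolding grad_sq_def by (intro tendsto_intros assms)

lemma mass_cutoff_ball_tendsto:
  assumes "vsummable (\<lambda>x. (u x)\<^sup>2)"
  shows "(\<lambda>k. mass (cutoff (graph_ball k) u)) \<longlonglongrightarrow> mass u"
  unfolding mass_def
  by (rule vsum_tendsto_dominated[OF assms])
    (use cutoff_ball_tendsto in \<open>auto simp: cutoff_def intro!: tendsto_power\<close>)

end

section \<open>Bounded potentials and the logarithmic Sobolev inequality\<close>

locale bounded_schroedinger = bounded_degree_graph +
  fixes V :: "'a \<Rightarrow> real" and K :: real
  assumes V_bound: "\<bar>V x\<bar> \<le> K"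
begin

lemma K_nonneg: "0 \<le> K"
  using V_bound[of x0] by linarith

lemma potential_bound: "\<bar>V x * (u x)\<^sup>2\<bar> \<le> K * (u x)\<^sup>2"
  using V_bound[of x] by (simp add: abs_mult mult_right_mono)

lemma potential_summable:
  assumes "vsummable (\<lambda>x. (u x)\<^sup>2)" shows "vsummable (\<lambda>x. V x * (u x)\<^sup>2)"
  by (rule vsummable_bound[of "\<lambda>x. K * (u x)\<^sup>2"]) (use assms potential_bound in auto)

lemma action_density_summable:
  assumes "u \<in> log_domain" shows "vsummable (action_density E V u)"
  unfolding action_density_def using assms grad_sq_summable potential_summable
  by (auto simp: log_domain_def)

lemma action_eq:
  assumes "u \<in> log_domain"
  shows "action E V u = vsum (grad_sq E u) + vsum (\<lambda>x. V x * (u x)\<^sup>2) - vsum (\<lambda>x. square_log (u x))"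
  unfolding action_def action_density_def using assms grad_sq_summable potential_summable
  by (auto simp: log_domain_def)

lemma action_scale:
  assumes "u \<in> log_domain" "s \<noteq> 0"
  shows "action E V (\<lambda>x. s * u x) = s\<^sup>2 * action E V u - s\<^sup>2 * ln (s\<^sup>2) * mass u"
proof -
  have "action_density E V (\<lambda>x. s * u x)
      = (\<lambda>x. s\<^sup>2 * action_density E V u x - s\<^sup>2 * ln (s\<^sup>2) * (u x)\<^sup>2)"
    unfolding action_density_def[abs_def]
    by (simp add: square_log_mult[OF assms(2)] grad_sq_scale power_mult_distrib algebra_simps)
  then show ?thesis
    using action_density_summable[OF assms(1)] assms(1)
    unfolding action_def mass_def log_domain_def by simp
qed

text \<open>
  On the unit sphere all values are at most \<open>1\<close> in modulus, so the entropy \<open>- \<Sum> u\<^sup>2 ln u\<^sup>2\<close> is a sum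
  of nonnegative terms. This gives both the lower bound on the action and the uniform control needed
  for Fatou arguments and for nonvanishing.
\<close>

lemma
  assumes "u \<in> log_domain" "mass u = 1"
  shows square_log_nonpos_unit: "square_log (u x) \<le> 0"
    and entropy_le_action: "- vsum (\<lambda>x. square_log (u x)) \<le> action E V u + K"
proof -
  have u2: "vsummable (\<lambda>x. (u x)\<^sup>2)" using assms(1) by (simp add: log_domain_def)
  show "square_log (u x) \<le> 0"
    using power2_le_mass[OF u2] assms(2) square_log_nonpos by simp
  have "vsum (\<lambda>x. - K * (u x)\<^sup>2) \<le> vsum (\<lambda>x. V x * (u x)\<^sup>2)"
    using u2 potential_summable[OF u2] potential_bound[of _ u]
    by (intro integral_mono) (auto simp: abs_le_iff minus_le_iff)
  moreover have "vsum (\<lambda>x. - K * (u x)\<^sup>2) = - K"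
    using assms(2) by (simp add: mass_def)
  moreover have "0 \<le> vsum (grad_sq E u)"
    by (simp add: grad_sq_nonneg)
  ultimately show "- vsum (\<lambda>x. square_log (u x)) \<le> action E V u + K"
    using action_eq[OF assms(1)] by linarith
qed

lemma action_bdd_below: "bdd_below (action E V ` {u \<in> log_domain. mass u = 1})"
proof (rule bdd_belowI[of _ "- K"])
  fix a assume "a \<in> action E V ` {u \<in> log_domain. mass u = 1}"
  then obtain u where u: "u \<in> log_domain" "mass u = 1" "a = action E V u" by auto
  have "0 \<le> vsum (\<lambda>x. - square_log (u x))"
    using square_log_nonpos_unit[OF u(1,2)] by (intro Bochner_Integration.integral_nonneg) simp
  then show "- K \<le> a"
    using entropy_le_action[OF u(1,2)] u(3) by simp
qed

lemma ground_level_le: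
  assumes "u \<in> log_domain" "mass u = 1" shows "ground_level E V \<le> action E V u"
  unfolding ground_level_def using assms action_bdd_below by (intro cINF_lower) auto

lemma minimizing_sequence:
  obtains u where "\<And>n. u n \<in> log_domain" "\<And>n. mass (u n) = 1"
    "(\<lambda>n. action E V (u n)) \<longlonglongrightarrow> ground_level E V"
proof -
  let ?A = "{u :: 'a \<Rightarrow> real. u \<in> log_domain \<and> mass u = 1}"
  define \<delta> :: "'a \<Rightarrow> real" where "\<delta> = (\<lambda>x. if x = x0 then 1 else 0)"
  have "\<delta> \<in> ?A"
    using vsummable_finite_support[of "{x0}"] vsum_finite_support[of "{x0}"]
    by (auto simp: \<delta>_def log_domain_def mass_def)
  then have ne: "action E V ` ?A \<noteq> {}" by auto
  have "\<exists>u\<in>?A. action E V u < ground_level E V + 1 / real (Suc n)" for n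
    using cInf_lessD[OF ne, of "ground_level E V + 1 / real (Suc n)"]
    by (auto simp: ground_level_def)
  then obtain u where u: "\<And>n. u n \<in> ?A" "\<And>n. action E V (u n) < ground_level E V + 1 / real (Suc n)"
    by metis
  have "(\<lambda>n. action E V (u n)) \<longlonglongrightarrow> ground_level E V"
  proof (rule tendsto_sandwich[OF always_eventually always_eventually])
    show "\<forall>n. ground_level E V \<le> action E V (u n)" using u(1) ground_level_le by simp
    show "\<forall>n. action E V (u n) \<le> ground_level E V + 1 / real (Suc n)" using u(2) less_imp_le by blast
    show "(\<lambda>n. ground_level E V + 1 / real (Suc n)) \<longlonglongrightarrow> ground_level E V"
      using tendsto_add[OF tendsto_const lim_inverse_n'[THEN LIMSEQ_Suc]] by simp
  qed simp
  with u(1) that show ?thesis by blast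
qed

text \<open>
  This is the definition of the infimum on the unit sphere, extended to all functions by scaling.
  It lets minimality be tested with pieces and perturbations that are not normalised.
\<close>

lemma log_sobolev:
  assumes "w \<in> log_domain"
  shows "ground_level E V * mass w - mass w * ln (mass w) \<le> action E V w"
proof (cases "\<exists>x. w x \<noteq> 0")
  case False
  then have "w = (\<lambda>x. 0)" by auto
  then show ?thesis
    by (simp add: mass_def action_def action_density_def[abs_def] grad_sq_def)
next
  case True
  then have m: "0 < mass w"
    using mass_pos assms by (auto simp: log_domain_def)
  define s where "s = 1 / sqrt (mass w)"
  have s: "s \<noteq> 0" "s\<^sup>2 = 1 / mass w" using m by (auto simp: s_def power_divide)
  have "ground_level E V \<le> action E V (\<lambda>x. s * w x)"
    using s m by (intro ground_level_le scale_in_log_domain assms) (simp add: mass_scale)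
  also have "\<dots> = (action E V w + mass w * ln (mass w)) / mass w"
    using m by (simp add: action_scale[OF assms s(1)] s(2) ln_div field_simps)
  finally show ?thesis using m by (simp add: field_simps)
qed

text \<open>
  A sharp cutoff makes potential and entropy additive without any error; only the gradient
  couples the two pieces.
\<close>

lemma action_cutoff:
  assumes "u \<in> log_domain"
  shows "action E V u = action E V (cutoff S u) + action E V (cutoff (- S) u)
    - vsum (cross E (cutoff S u) (cutoff (- S) u))"
proof -
  have u2: "vsummable (\<lambda>x. (u x)\<^sup>2)" using assms by (simp add: log_domain_def)
  have "action_density E V u = (\<lambda>x. action_density E V (cutoff S u) x
      + action_density E V (cutoff (- S) u) x - cross E (cutoff S u) (cutoff (- S) u) x)"
  proof
    fix x
    have "1/2 * (u y - u x)\<^sup>2 = 1/2 * (cutoff S u y - cutoff S u x)\<^sup>2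
        + 1/2 * (cutoff (- S) u y - cutoff (- S) u x)\<^sup>2
        - (cutoff S u x * cutoff (- S) u y + cutoff S u y * cutoff (- S) u x)" for y
      by (auto simp: cutoff_def power2_eq_square algebra_simps)
    then have "grad_sq E u x = grad_sq E (cutoff S u) x + grad_sq E (cutoff (- S) u) x
        - cross E (cutoff S u) (cutoff (- S) u) x"
      unfolding grad_sq_def cross_def sum_distrib_left sum.distrib[symmetric] sum_subtractf[symmetric]
      by (intro sum.cong refl)
    then show "action_density E V u x = action_density E V (cutoff S u) x
        + action_density E V (cutoff (- S) u) x - cross E (cutoff S u) (cutoff (- S) u) x"
      by (auto simp: action_density_def cutoff_def)
  qed
  moreover have "vsummable (cross E (cutoff S u) (cutoff (- S) u))"
    by (rule vsummable_bound[OF nbr_mass_summable[OF u2] cross_le_nbr_mass])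
  ultimately show ?thesis
    using action_density_summable[OF cutoff_in_log_domain[OF assms]]
    unfolding action_def by simp
qed

lemma action_cutoff_ball_tendsto:
  assumes "u \<in> log_domain"
  shows "(\<lambda>k. action E V (cutoff (graph_ball k) u)) \<longlonglongrightarrow> action E V u"
  unfolding action_def
proof (rule vsum_tendsto_dominated)
  let ?g = "\<lambda>x. nbr_mass u x + K * (u x)\<^sup>2 + \<bar>square_log (u x)\<bar>"
  show "vsummable ?g" using assms nbr_mass_summable by (auto simp: log_domain_def)
  show "\<bar>action_density E V (cutoff (graph_ball k) u) x\<bar> \<le> ?g x" for k x
  proof -
    have "\<bar>grad_sq E (cutoff (graph_ball k) u) x\<bar> \<le> nbr_mass u x"
      using grad_sq_le_nbr_mass nbr_mass_cutoff_le grad_sq_nonneg by (smt (verit))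
    moreover have "\<bar>V x * (cutoff (graph_ball k) u x)\<^sup>2\<bar> \<le> K * (u x)\<^sup>2"
      using potential_bound[of x u] K_nonneg by (auto simp: cutoff_def)
    moreover have "\<bar>square_log (cutoff (graph_ball k) u x)\<bar> \<le> \<bar>square_log (u x)\<bar>"
      by (auto simp: cutoff_def)
    ultimately show ?thesis unfolding action_density_def by linarith
  qed
  show "(\<lambda>k. action_density E V (cutoff (graph_ball k) u) x) \<longlonglongrightarrow> action_density E V u x" for x
    unfolding action_density_def
    by (intro tendsto_intros tendsto_grad_sq cutoff_ball_tendsto)
qed

end

context bounded_schroedinger
begin

section \<open>Compactness of minimising sequences\<close>

text \<open>
  The limit \<open>v\<close> keeps some mass \<open>m \<in> (0, 1]\<close>. For a ball \<open>B\<close>, split \<open>u n\<close> into its restrictions to \<open>B\<close>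
  and to the complement, bound the outer piece from below by \<open>log_sobolev\<close>, and let \<open>n\<close> tend to
  infinity: the inner piece lives on a finite set, so pointwise convergence suffices. Letting \<open>B\<close> grow
  then gives \<open>Q(v) + c (1 - m) - (1 - m) ln (1 - m) \<le> c\<close>. Combined with
  \<open>log_sobolev\<close> for \<open>v\<close> this says \<open>m ln m + (1 - m) ln (1 - m) \<ge> 0\<close>, which forces \<open>m = 1\<close>, and then
  \<open>Q(v) \<le> c\<close>.
\<close>

lemma minimizing_limit:
  assumes dom: "\<And>n. u n \<in> log_domain" and unit: "\<And>n. mass (u n) = 1"
    and lim: "(\<lambda>n. action E V (u n)) \<longlonglongrightarrow> ground_level E V"
    and pw: "\<And>x. (\<lambda>n. u n x) \<longlonglongrightarrow> v x" and nonzero: "v z \<noteq> 0"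
  shows "minimizer E V v"
proof -
  let ?c = "ground_level E V"
  have u2: "vsummable (\<lambda>x. (u n x)\<^sup>2)" and ul: "vsummable (\<lambda>x. square_log (u n x))" for n
    using dom[of n] by (auto simp: log_domain_def)
  have sum1: "(\<Sum>x\<in>graph_ball k. (v x)\<^sup>2) \<le> 1" for k
  proof (rule LIMSEQ_le_const2)
    show "(\<lambda>n. \<Sum>x\<in>graph_ball k. (u n x)\<^sup>2) \<longlonglongrightarrow> (\<Sum>x\<in>graph_ball k. (v x)\<^sup>2)"
      by (intro tendsto_intros pw)
    show "\<exists>N. \<forall>n\<ge>N. (\<Sum>x\<in>graph_ball k. (u n x)\<^sup>2) \<le> 1"
      using sum_le_vsum[OF finite_graph_ball u2] unit by (simp add: mass_def)
  qed
  have v2: "vsummable (\<lambda>x. (v x)\<^sup>2)"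
    by (rule vsummable_bounded_sums[OF exhaustion_graph_ball _ sum1]) simp
  have mass_le: "mass v \<le> 1"
    unfolding mass_def by (rule vsum_le_bounded_sums[OF exhaustion_graph_ball _ sum1]) simp
  have mass_gt: "0 < mass v" by (rule mass_pos[OF v2 nonzero])
  obtain C where C: "\<And>n. action E V (u n) \<le> C"
    using convergent_imp_Bseq[OF convergentI[OF lim]] unfolding Bseq_def
    by (metis real_norm_def abs_le_D1)
  have sum2: "(\<Sum>x\<in>graph_ball k. - square_log (v x)) \<le> C + K" for k
  proof (rule LIMSEQ_le_const2)
    show "(\<lambda>n. \<Sum>x\<in>graph_ball k. - square_log (u n x)) \<longlonglongrightarrow> (\<Sum>x\<in>graph_ball k. - square_log (v x))"
      by (intro tendsto_intros pw)
    have "(\<Sum>x\<in>graph_ball k. - square_log (u n x)) \<le> C + K" for n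
    proof -
      have "(\<Sum>x\<in>graph_ball k. - square_log (u n x)) \<le> vsum (\<lambda>x. - square_log (u n x))"
        using square_log_nonpos_unit[OF dom unit] ul by (intro sum_le_vsum finite_graph_ball) auto
      then show ?thesis using entropy_le_action[OF dom unit, of n] C[of n] by simp
    qed
    then show "\<exists>N. \<forall>n\<ge>N. (\<Sum>x\<in>graph_ball k. - square_log (u n x)) \<le> C + K" by blast
  qed
  have nonneg: "0 \<le> - square_log (v x)" for x
    using square_log_nonpos power2_le_mass[OF v2, of x] mass_le by simp
  have "vsummable (\<lambda>x. - square_log (v x))"
    by (rule vsummable_bounded_sums[OF exhaustion_graph_ball nonneg sum2])
  then have v_dom: "v \<in> log_domain"
    using v2 by (simp add: log_domain_def)
  \<comment> \<open>Splitting at a fixed ball, in the limit along the minimising sequence.\<close>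
  have cut: "action E V (cutoff (graph_ball k) v)
      + (?c * (1 - mass (cutoff (graph_ball k) v)) - (1 - mass (cutoff (graph_ball k) v)) * ln (1 - mass (cutoff (graph_ball k) v)))
      - vsum (cross E (cutoff (graph_ball k) v) (cutoff (- graph_ball k) v)) \<le> ?c" (is "?R k \<le> ?c") for k
  proof (rule LIMSEQ_le[OF _ lim])
    \<comment> \<open>The densities of the inner piece live on the ball together with its neighbours.\<close>
    let ?S = "graph_ball k \<union> (\<Union>y\<in>graph_ball k. {x. E y x})"
    have fin_S: "finite ?S" using finite_graph_ball fin by auto
    have near: "y \<notin> graph_ball k" if "x \<notin> ?S" "E x y \<or> x = y" for x y
      using that sym by blast
    define m where "m = (\<lambda>n. mass (cutoff (graph_ball k) (u n)))"
    have pw': "(\<lambda>n. cutoff S (u n) x) \<longlonglongrightarrow> cutoff S v x" for S x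
      using pw by (auto simp: cutoff_def)
    have inner: "(\<lambda>n. action E V (cutoff (graph_ball k) (u n))) \<longlonglongrightarrow> action E V (cutoff (graph_ball k) v)"
      unfolding action_def
    proof (rule vsum_tendsto_finite_support[OF fin_S])
      show "action_density E V (cutoff (graph_ball k) (u n)) x = 0" if "x \<notin> ?S" for n x
        using near[OF that] by (auto simp: action_density_def grad_sq_def cutoff_def)
      show "(\<lambda>n. action_density E V (cutoff (graph_ball k) (u n)) x)
          \<longlonglongrightarrow> action_density E V (cutoff (graph_ball k) v) x" for x
        unfolding action_density_def by (intro tendsto_intros tendsto_grad_sq pw')
    qed
    have interaction: "(\<lambda>n. vsum (cross E (cutoff (graph_ball k) (u n)) (cutoff (- graph_ball k) (u n))))
        \<longlonglongrightarrow> vsum (cross E (cutoff (graph_ball k) v) (cutoff (- graph_ball k) v))"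
    proof (rule vsum_tendsto_finite_support[OF fin_S])
      show "cross E (cutoff (graph_ball k) (u n)) (cutoff (- graph_ball k) (u n)) x = 0" if "x \<notin> ?S" for n x
        using near[OF that] by (auto simp: cross_def cutoff_def)
      show "(\<lambda>n. cross E (cutoff (graph_ball k) (u n)) (cutoff (- graph_ball k) (u n)) x)
          \<longlonglongrightarrow> cross E (cutoff (graph_ball k) v) (cutoff (- graph_ball k) v) x" for x
        unfolding cross_def by (intro tendsto_intros pw')
    qed
    have m: "m \<longlonglongrightarrow> mass (cutoff (graph_ball k) v)"
      unfolding m_def mass_def
    proof (rule vsum_tendsto_finite_support[OF finite_graph_ball[of k]])
      show "(\<lambda>n. (cutoff (graph_ball k) (u n) x)\<^sup>2) \<longlonglongrightarrow> (cutoff (graph_ball k) v x)\<^sup>2" for x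
        by (intro tendsto_intros pw')
    qed (auto simp: cutoff_def)
    have rest: "mass (cutoff (- graph_ball k) (u n)) = 1 - m n" for n
      using mass_cutoff[OF u2, of n "graph_ball k"] unit[of n] by (simp add: m_def)
    have outer: "(\<lambda>n. (1 - m n) * ln (1 - m n))
        \<longlonglongrightarrow> (1 - mass (cutoff (graph_ball k) v)) * ln (1 - mass (cutoff (graph_ball k) v))"
    proof (rule tendsto_x_ln_x)
      show "(\<lambda>n. 1 - m n) \<longlonglongrightarrow> 1 - mass (cutoff (graph_ball k) v)"
        by (intro tendsto_intros m)
      show "0 \<le> 1 - m n" for n using mass_nonneg[of "cutoff (- graph_ball k) (u n)"] rest by simp
      show "0 \<le> 1 - mass (cutoff (graph_ball k) v)"
        using mass_cutoff[OF v2, of "graph_ball k"] mass_nonneg[of "cutoff (- graph_ball k) v"] mass_le by simp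
    qed
    show "(\<lambda>n. action E V (cutoff (graph_ball k) (u n)) + (?c * (1 - m n) - (1 - m n) * ln (1 - m n))
        - vsum (cross E (cutoff (graph_ball k) (u n)) (cutoff (- graph_ball k) (u n)))) \<longlonglongrightarrow> ?R k"
      by (intro tendsto_diff[OF tendsto_add[OF inner tendsto_diff[OF tendsto_mult_left outer]] interaction]
          tendsto_diff[OF tendsto_const m])
    have "action E V (cutoff (graph_ball k) (u n)) + (?c * (1 - m n) - (1 - m n) * ln (1 - m n))
        - vsum (cross E (cutoff (graph_ball k) (u n)) (cutoff (- graph_ball k) (u n))) \<le> action E V (u n)" for n
      using action_cutoff[OF dom, of n "graph_ball k"]
        log_sobolev[OF cutoff_in_log_domain[OF dom], of "- graph_ball k" n] rest[of n] by simp
    then show "\<exists>N. \<forall>n\<ge>N. action E V (cutoff (graph_ball k) (u n)) + (?c * (1 - m n) - (1 - m n) * ln (1 - m n))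
        - vsum (cross E (cutoff (graph_ball k) (u n)) (cutoff (- graph_ball k) (u n))) \<le> action E V (u n)"
      by blast
  qed
  have "?R \<longlonglongrightarrow> action E V v + (?c * (1 - mass v) - (1 - mass v) * ln (1 - mass v)) - 0"
  proof (intro tendsto_diff tendsto_add tendsto_mult_left tendsto_const
      action_cutoff_ball_tendsto[OF v_dom] mass_cutoff_ball_tendsto[OF v2] cross_tendsto_0[OF v2] tendsto_x_ln_x)
    show "0 \<le> 1 - mass (cutoff (graph_ball k) v)" for k
      using mass_cutoff[OF v2, of "graph_ball k"] mass_nonneg[of "cutoff (- graph_ball k) v"] mass_le by simp
  qed (use mass_le in simp)
  then have upper: "action E V v + (?c * (1 - mass v) - (1 - mass v) * ln (1 - mass v)) \<le> ?c"
    using LIMSEQ_le_const2[of ?R _ ?c] cut by force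
  have "mass v = 1"
  proof (rule ccontr)
    assume "mass v \<noteq> 1"
    with mass_le have "mass v < 1" by simp
    then have "mass v * ln (mass v) < 0" "(1 - mass v) * ln (1 - mass v) < 0"
      using mass_gt by (auto simp: mult_pos_neg)
    then show False
      using upper log_sobolev[OF v_dom] by (simp add: algebra_simps)
  qed
  then show ?thesis
    using upper ground_level_le[OF v_dom] v_dom by (simp add: minimizer_def)
qed

text \<open>
  If \<open>u\<^sup>2\<close> were everywhere below the bound, then \<open>- ln u\<^sup>2\<close> would exceed \<open>C + K + 1\<close> wherever
  \<open>u \<noteq> 0\<close>, and so would its \<open>u\<^sup>2\<close>-weighted mean, the entropy; but the entropy is at most \<open>C + K\<close>.
\<close>

lemma nonvanishing:
  assumes dom: "u \<in> log_domain" and unit: "mass u = 1" and "action E V u \<le> C"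
  shows "\<exists>x. exp (- (C + K + 1)) \<le> (u x)\<^sup>2"
proof (rule ccontr)
  assume "\<not> ?thesis"
  then have small: "(u x)\<^sup>2 < exp (- (C + K + 1))" for x by (simp add: not_le)
  have "(C + K + 1) * (u x)\<^sup>2 \<le> - square_log (u x)" for x
  proof (cases "u x = 0")
    case False
    then have "ln ((u x)\<^sup>2) \<le> - (C + K + 1)"
      using small[of x] ln_less_cancel_iff[of "(u x)\<^sup>2" "exp (- (C + K + 1))"] by simp
    then have "(u x)\<^sup>2 * ln ((u x)\<^sup>2) \<le> (u x)\<^sup>2 * (- (C + K + 1))"
      by (rule mult_left_mono) simp
    then show ?thesis by (simp add: square_log_def algebra_simps)
  qed simp
  then have "vsum (\<lambda>x. (C + K + 1) * (u x)\<^sup>2) \<le> vsum (\<lambda>x. - square_log (u x))"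
    using dom by (intro integral_mono) (auto simp: log_domain_def)
  then have "C + K + 1 \<le> - vsum (\<lambda>x. square_log (u x))"
    using unit by (simp add: mass_def)
  then show False
    using entropy_le_action[OF dom unit] assms(3) by simp
qed

lemma unit_bounded:
  assumes "u \<in> log_domain" "mass u = 1" shows "norm (u x) \<le> 1"
  using power2_le_mass[of u x] assms by (simp add: log_domain_def abs_square_le_1)

lemma pointwise_limit:
  fixes u :: "nat \<Rightarrow> 'a \<Rightarrow> real"
  assumes "\<And>n. u n \<in> log_domain" "\<And>n. mass (u n) = 1"
  obtains k v where "strict_mono (k :: nat \<Rightarrow> nat)" "\<And>x. (\<lambda>n. u (k n) x) \<longlonglongrightarrow> v x"
proof -
  obtain k where k: "strict_mono (k :: nat \<Rightarrow> nat)" "\<And>x. x \<in> UNIV \<Longrightarrow> \<exists>l. (\<lambda>n. u (k n) x) \<longlonglongrightarrow> l"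
    using function_convergent_subsequence[OF countable_vertices, of u 1] unit_bounded[OF assms] by blast
  then obtain v where "\<And>x. (\<lambda>n. u (k n) x) \<longlonglongrightarrow> v x" by (metis UNIV_I)
  with k(1) that show ?thesis by blast
qed

end

section \<open>Existence of minimisers\<close>

lemma log_domain_translate:
  assumes "bij \<gamma>" shows "(\<lambda>x. u (\<gamma> x)) \<in> log_domain \<longleftrightarrow> u \<in> log_domain"
  using integrable_bij_count_space[OF assms, of "\<lambda>x. (u x)\<^sup>2"]
    integrable_bij_count_space[OF assms, of "\<lambda>x. square_log (u x)"]
  by (simp add: log_domain_def)

lemma mass_translate:
  assumes "bij \<gamma>" shows "mass (\<lambda>x. u (\<gamma> x)) = mass u"
  unfolding mass_def by (rule integral_bij_count_space[OF assms])

lemma nbrs_automorphism: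
  assumes "bij \<gamma>" and "\<And>x y. E (\<gamma> x) (\<gamma> y) \<longleftrightarrow> E x y"
  shows "{y. E (\<gamma> x) y} = \<gamma> ` {y. E x y}"
proof -
  have "{y. E (\<gamma> x) y} = \<gamma> ` (\<gamma> -` {y. E (\<gamma> x) y})"
    using assms(1) by (metis bij_is_surj surj_image_vimage_eq)
  then show ?thesis by (simp add: vimage_def assms(2))
qed

lemma action_translate:
  assumes bij: "bij \<gamma>" and aut: "\<And>x y. E (\<gamma> x) (\<gamma> y) \<longleftrightarrow> E x y" and inv: "\<And>x. V (\<gamma> x) = V x"
  shows "action E V (\<lambda>x. u (\<gamma> x)) = action E V u"
proof -
  have "{y. E (\<gamma> x) y} = \<gamma> ` {y. E x y}" for x
    by (rule nbrs_automorphism[of \<gamma> E, OF bij aut])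
  then have "grad_sq E (\<lambda>x. u (\<gamma> x)) x = grad_sq E u (\<gamma> x)" for x
    using bij by (simp add: grad_sq_def sum.reindex bij_def inj_on_def inj_def)
  then have "action_density E V (\<lambda>x. u (\<gamma> x)) = (\<lambda>x. action_density E V u (\<gamma> x))"
    by (simp add: action_density_def[abs_def] inv)
  then show "action E V (\<lambda>x. u (\<gamma> x)) = action E V u"
    unfolding action_def by (simp add: integral_bij_count_space[OF bij])
qed

context bounded_schroedinger
begin

text \<open>
  Nonvanishing provides, for each member of a minimising sequence, a vertex where it is large. A
  translation moves this vertex into \<open>R\<close>. Which element of \<open>R\<close> is hit may depend on the member, so
  the sum of the squares over \<open>R\<close> is used: it stays bounded below in the limit.
\<close>

lemma minimizer_if_cocompact:
  assumes "finite R" and cover: "\<And>x. \<exists>r\<in>R. \<exists>\<gamma>\<in>\<Gamma>. \<gamma> r = x"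
    and bij: "\<And>\<gamma>. \<gamma> \<in> \<Gamma> \<Longrightarrow> bij \<gamma>"
    and aut: "\<And>\<gamma> x y. \<gamma> \<in> \<Gamma> \<Longrightarrow> E (\<gamma> x) (\<gamma> y) \<longleftrightarrow> E x y"
    and inv: "\<And>\<gamma> x. \<gamma> \<in> \<Gamma> \<Longrightarrow> V (\<gamma> x) = V x"
  shows "\<exists>u. minimizer E V u"
proof -
  obtain u where u: "\<And>n. u n \<in> log_domain" "\<And>n. mass (u n) = 1"
    "(\<lambda>n. action E V (u n)) \<longlonglongrightarrow> ground_level E V"
    by (rule minimizing_sequence) blast
  obtain C where C: "\<And>n. action E V (u n) \<le> C"
    using convergent_imp_Bseq[OF convergentI[OF u(3)]] unfolding Bseq_def
    by (metis real_norm_def abs_le_D1)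
  define \<delta> where "\<delta> = exp (- (C + K + 1))"
  have "\<exists>r\<in>R. \<exists>\<gamma>\<in>\<Gamma>. \<delta> \<le> (u n (\<gamma> r))\<^sup>2" for n
    using nonvanishing[OF u(1) u(2) C, of n] cover unfolding \<delta>_def by metis
  then obtain r \<gamma> where r: "\<And>n. r n \<in> R" and \<gamma>: "\<And>n. \<gamma> n \<in> \<Gamma>" "\<And>n. \<delta> \<le> (u n (\<gamma> n (r n)))\<^sup>2"
    by metis
  define w where "w = (\<lambda>n x. u n (\<gamma> n x))"
  have "w n \<in> log_domain" "mass (w n) = mass (u n)" "action E V (w n) = action E V (u n)" for n
    using log_domain_translate[of "\<gamma> n" "u n"] mass_translate[of "\<gamma> n" "u n"]
      action_translate[of "\<gamma> n" E V "u n"] bij[OF \<gamma>(1)] aut[OF \<gamma>(1)] inv[OF \<gamma>(1)] u(1)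
    by (auto simp: w_def)
  then have w: "\<And>n. w n \<in> log_domain" "\<And>n. mass (w n) = 1"
    "(\<lambda>n. action E V (w n)) \<longlonglongrightarrow> ground_level E V"
    using u(2,3) by simp_all
  obtain k v where k: "strict_mono k" and v: "\<And>x. (\<lambda>n. w (k n) x) \<longlonglongrightarrow> v x"
    by (rule pointwise_limit[of w, OF w(1,2)]) blast
  have "\<delta> \<le> (\<Sum>r\<in>R. (w n r)\<^sup>2)" for n
    using \<gamma>(2)[of n] member_le_sum[OF r[of n], of "\<lambda>r. (w n r)\<^sup>2"] \<open>finite R\<close>
    by (simp add: w_def)
  then have "\<delta> \<le> (\<Sum>r\<in>R. (v r)\<^sup>2)"
    by (intro LIMSEQ_le_const[where X = "\<lambda>n. \<Sum>r\<in>R. (w (k n) r)\<^sup>2"] tendsto_intros v) auto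
  moreover have "0 < \<delta>" by (simp add: \<delta>_def)
  ultimately have "\<exists>z. v z \<noteq> 0" by (intro ccontr[of "\<exists>z. v z \<noteq> 0"]) simp
  then obtain z where "v z \<noteq> 0" by blast
  then show ?thesis
    using minimizing_limit[of "\<lambda>n. w (k n)" v z] w v LIMSEQ_subseq_LIMSEQ[OF w(3) k]
    by (auto simp: o_def)
qed

text \<open>
  There need be no translations that preserve \<open>V\<close>, so escape of the whole mass to infinity is excluded
  by comparing with \<open>W\<close>: escaping mass sees only \<open>W\<close>, whose ground level is strictly higher.
\<close>

lemma minimizer_if_below:
  assumes W: "bounded_schroedinger E D W K'"
    and le: "\<And>x. V x \<le> W x" and strict: "V z < W z"
    and decay: "((\<lambda>x. \<bar>V x - W x\<bar>) \<longlongrightarrow> 0) (at_graph_infinity E x0)"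
    and p: "minimizer E W p" "p z \<noteq> 0"
  shows "\<exists>u. minimizer E V u"
proof -
  interpret W: bounded_schroedinger E x0 D W K' by (fact W)
  obtain u where u: "\<And>n. u n \<in> log_domain" "\<And>n. mass (u n) = 1"
    "(\<lambda>n. action E V (u n)) \<longlonglongrightarrow> ground_level E V"
    by (rule minimizing_sequence) blast
  obtain k v where k: "strict_mono k" and v: "\<And>x. (\<lambda>n. u (k n) x) \<longlonglongrightarrow> v x"
    by (rule pointwise_limit[of u, OF u(1,2)]) blast
  define w where "w = (\<lambda>n. u (k n))"
  have w: "\<And>n. w n \<in> log_domain" "\<And>n. mass (w n) = 1"
    "(\<lambda>n. action E V (w n)) \<longlonglongrightarrow> ground_level E V" "\<And>x. (\<lambda>n. w n x) \<longlonglongrightarrow> v x"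
    using u v LIMSEQ_subseq_LIMSEQ[OF u(3) k] by (auto simp: w_def o_def)
  have action_diff: "action E W f = action E V f + vsum (\<lambda>x. (W x - V x) * (f x)\<^sup>2)"
    and diff_summable: "vsummable (\<lambda>x. (W x - V x) * (f x)\<^sup>2)"
    if "f \<in> log_domain" for f
  proof -
    have f2: "vsummable (\<lambda>x. (f x)\<^sup>2)" using that by (simp add: log_domain_def)
    note s = potential_summable[OF f2] W.potential_summable[OF f2]
    show "vsummable (\<lambda>x. (W x - V x) * (f x)\<^sup>2)"
      using s by (simp add: left_diff_distrib)
    show "action E W f = action E V f + vsum (\<lambda>x. (W x - V x) * (f x)\<^sup>2)"
      using s by (simp add: action_eq[OF that] W.action_eq[OF that] left_diff_distrib)
  qed
  have "ground_level E V < ground_level E W"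
  proof -
    have pd: "p \<in> log_domain" "mass p = 1" "action E W p = ground_level E W"
      using p(1) by (auto simp: minimizer_def)
    have "0 < (W z - V z) * (p z)\<^sup>2" using strict p(2) by simp
    also have "\<dots> \<le> vsum (\<lambda>x. (W x - V x) * (p x)\<^sup>2)"
      using sum_le_vsum[of "{z}" "\<lambda>x. (W x - V x) * (p x)\<^sup>2"] diff_summable[OF pd(1)] le by simp
    finally show ?thesis
      using ground_level_le[OF pd(1,2)] action_diff[OF pd(1)] pd(3) by simp
  qed
  moreover have "ground_level E W \<le> ground_level E V" if "\<And>x. v x = 0"
  proof (rule field_le_epsilon)
    fix e :: real assume "0 < e"
    then have "eventually (\<lambda>x. \<bar>V x - W x\<bar> < e) (at_graph_infinity E x0)"
      using decay by (auto simp: tendsto_iff dist_real_def)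
    then obtain N where N: "\<And>x. N \<le> graph_dist E x x0 \<Longrightarrow> \<bar>V x - W x\<bar> < e"
      by (auto simp: at_graph_infinity_def eventually_filtercomap eventually_at_top_linorder)
    have bound: "action E W (w n) \<le> action E V (w n) + (\<Sum>x\<in>graph_ball N. (W x - V x) * (w n x)\<^sup>2) + e" for n
    proof -
      let ?g = "\<lambda>x. if x \<in> graph_ball N then (W x - V x) * (w n x)\<^sup>2 else 0"
      have w2: "vsummable (\<lambda>x. (w n x)\<^sup>2)" using w(1)[of n] by (simp add: log_domain_def)
      have g: "vsummable ?g" "vsum ?g = (\<Sum>x\<in>graph_ball N. (W x - V x) * (w n x)\<^sup>2)"
        using vsummable_finite_support[OF finite_graph_ball, of N ?g] vsum_finite_support[OF finite_graph_ball, of N ?g]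
        by auto
      have "(W x - V x) * (w n x)\<^sup>2 \<le> ?g x + e * (w n x)\<^sup>2" for x
      proof (cases "x \<in> graph_ball N")
        case False
        then have "W x - V x \<le> e" using N[of x] by (simp add: graph_ball_def)
        then show ?thesis using False by (simp add: mult_right_mono)
      qed (use \<open>0 < e\<close> in simp)
      then have "vsum (\<lambda>x. (W x - V x) * (w n x)\<^sup>2) \<le> vsum (\<lambda>x. ?g x + e * (w n x)\<^sup>2)"
        using diff_summable[OF w(1)] g(1) w2 by (intro integral_mono) auto
      also have "\<dots> = vsum ?g + e * mass (w n)"
        using g(1) w2 by (simp add: mass_def)
      finally show ?thesis using g(2) w(2) action_diff[OF w(1)] by simp
    qed
    have "(\<lambda>n. action E V (w n) + (\<Sum>x\<in>graph_ball N. (W x - V x) * (w n x)\<^sup>2) + e)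
        \<longlonglongrightarrow> ground_level E V + (\<Sum>x\<in>graph_ball N. (W x - V x) * (v x)\<^sup>2) + e"
      by (intro tendsto_intros w(3,4))
    moreover have "ground_level E W
        \<le> action E V (w n) + (\<Sum>x\<in>graph_ball N. (W x - V x) * (w n x)\<^sup>2) + e" for n
      using W.ground_level_le[OF w(1,2)] bound[of n] by (rule order_trans)
    ultimately have "ground_level E W \<le> ground_level E V + (\<Sum>x\<in>graph_ball N. (W x - V x) * (v x)\<^sup>2) + e"
      by (intro LIMSEQ_le_const) auto
    then show "ground_level E W \<le> ground_level E V + e" using that by simp
  qed
  ultimately obtain y where "v y \<noteq> 0" by fastforce
  then show ?thesis using minimizing_limit[OF w(1-4)] by blast
qed

end

context bounded_schroedinger
begin

section \<open>Euler-Lagrange equation and positivity\<close>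

lemma minimizer_abs:
  assumes "minimizer E V u" shows "minimizer E V (\<lambda>x. \<bar>u x\<bar>)"
proof -
  have u: "u \<in> log_domain" "mass u = 1" "action E V u = ground_level E V"
    using assms by (auto simp: minimizer_def)
  have a: "(\<lambda>x. \<bar>u x\<bar>) \<in> log_domain" "mass (\<lambda>x. \<bar>u x\<bar>) = 1"
    using u(1,2) by (simp_all add: log_domain_def mass_def)
  have "action E V (\<lambda>x. \<bar>u x\<bar>) \<le> action E V u"
    unfolding action_def using action_density_summable[OF u(1)] action_density_summable[OF a(1)]
    by (intro integral_mono) (auto simp: action_density_def grad_sq_abs_le)
  then show ?thesis
    using a u(3) ground_level_le[OF a] by (simp add: minimizer_def)
qed

text \<open>
  The Dirichlet form is expanded along a perturbation at the single vertex \<open>x\<close>. The mixed term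
  \<open>\<Sum>y\<sim>z. (u y - u z) (\<delta> y - \<delta> z)\<close>, with \<open>\<delta>\<close> the indicator of \<open>x\<close>, is, as a function
  of \<open>z\<close>, supported on \<open>x\<close> and its neighbours (\<open>at_x\<close> and \<open>in_nbr\<close>), and each of the two parts contributes \<open>- laplacian E u x\<close> to its sum.
\<close>

lemma vsum_grad_sq_update:
  assumes u2: "vsummable (\<lambda>x. (u x)\<^sup>2)"
  shows "vsum (grad_sq E (u(x := u x + s))) = vsum (grad_sq E u) - 2 * s * laplacian E u x
    + s\<^sup>2 * vsum (grad_sq E (indicator {x}))"
proof -
  define \<delta> :: "'a \<Rightarrow> real" where "\<delta> = indicator {x}"
  define in_nbr where "in_nbr = (\<lambda>z. if E z x then u x - u z else 0)"
  define at_x where "at_x = (\<lambda>z. if z = x then laplacian E u x else 0)"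
  have nbr: "vsummable in_nbr" "vsum in_nbr = - laplacian E u x"
  proof -
    have supp: "in_nbr z = 0" if "z \<notin> {z. E x z}" for z using that sym by (auto simp: in_nbr_def)
    show "vsummable in_nbr" by (rule vsummable_finite_support[OF fin supp])
    have "vsum in_nbr = (\<Sum>z | E x z. in_nbr z)" by (rule vsum_finite_support[OF fin supp])
    also have "\<dots> = (\<Sum>z | E x z. - (u z - u x))"
      using sym by (intro sum.cong) (auto simp: in_nbr_def)
    finally show "vsum in_nbr = - laplacian E u x"
      by (simp add: laplacian_def sum_negf[symmetric])
  qed
  have at: "vsummable at_x" "vsum at_x = laplacian E u x"
    using vsummable_finite_support[of "{x}" at_x] vsum_finite_support[of "{x}" at_x]
    by (auto simp: at_x_def)
  have "vsummable (\<lambda>z. (\<delta> z)\<^sup>2)"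
    by (rule vsummable_finite_support[of "{x}"]) (auto simp: \<delta>_def)
  then have \<delta>: "vsummable (grad_sq E \<delta>)" by (rule grad_sq_summable)
  have "grad_sq E (u(x := u x + s)) = (\<lambda>z. grad_sq E u z + s * (in_nbr z - at_x z) + s\<^sup>2 * grad_sq E \<delta> z)"
  proof
    fix z
    have "u(x := u x + s) = (\<lambda>y. u y + s * \<delta> y)" by (auto simp: \<delta>_def)
    then have "grad_sq E (u(x := u x + s)) z = 1/2 * (\<Sum>y | E z y. (u y - u z)\<^sup>2
        + 2 * s * ((u y - u z) * \<delta> y - (u y - u z) * \<delta> z) + s\<^sup>2 * (\<delta> y - \<delta> z)\<^sup>2)"
      by (simp add: grad_sq_def power2_eq_square algebra_simps)
    also have "\<dots> = grad_sq E u z + s * ((\<Sum>y | E z y. (u y - u z) * \<delta> y) - laplacian E u z * \<delta> z)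
        + s\<^sup>2 * grad_sq E \<delta> z"
      by (simp add: grad_sq_def laplacian_def sum.distrib sum_subtractf sum_distrib_left[symmetric]
          sum_distrib_right[symmetric])
    also have "(\<Sum>y | E z y. (u y - u z) * \<delta> y) = in_nbr z"
    proof -
      have "(\<Sum>y | E z y. (u y - u z) * \<delta> y) = (\<Sum>y | E z y. if y = x then u x - u z else 0)"
        by (intro sum.cong) (auto simp: \<delta>_def)
      then show ?thesis using fin by (simp add: in_nbr_def)
    qed
    also have "laplacian E u z * \<delta> z = at_x z" by (auto simp: at_x_def \<delta>_def)
    finally show "grad_sq E (u(x := u x + s)) z
        = grad_sq E u z + s * (in_nbr z - at_x z) + s\<^sup>2 * grad_sq E \<delta> z" .
  qed
  then show ?thesis
    using nbr at \<delta> grad_sq_summable[OF u2] by (simp add: \<delta>_def)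
qed

text \<open>
  Perturbing a minimiser at one vertex changes mass, potential and entropy in one summand only.
  By \<open>log_sobolev\<close> the explicit function \<open>g\<close> of the perturbation size is nonnegative and vanishes at \<open>0\<close>, so
  its derivative there is \<open>0\<close>.
\<close>

lemma minimizer_euler_lagrange:
  assumes "minimizer E V u"
  shows "- laplacian E u x + V x * u x - u x * ln ((u x)\<^sup>2) = ground_level E V * u x"
proof -
  let ?c = "ground_level E V" and ?w = "\<lambda>s. u(x := u x + s)"
  define d where "d = vsum (grad_sq E (indicator {x}))"
  have u: "u \<in> log_domain" "mass u = 1" "action E V u = ?c"
    using assms by (auto simp: minimizer_def)
  then have u2: "vsummable (\<lambda>x. (u x)\<^sup>2)" and ul: "vsummable (\<lambda>x. square_log (u x))"
    by (auto simp: log_domain_def)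
  have w: "?w s \<in> log_domain" for s
    using vsummable_update[of x "\<lambda>y. (?w s y)\<^sup>2" "\<lambda>y. (u y)\<^sup>2"] u2
      vsummable_update[of x "\<lambda>y. square_log (?w s y)" "\<lambda>y. square_log (u y)"] ul
    by (simp add: log_domain_def)
  have mass_w: "mass (?w s) = 1 + 2 * u x * s + s\<^sup>2" for s
    using vsum_update[of x "\<lambda>y. (?w s y)\<^sup>2" "\<lambda>y. (u y)\<^sup>2"] u2 u(2)
    by (simp add: mass_def power2_eq_square algebra_simps)
  have action_w: "action E V (?w s) = ?c - 2 * s * laplacian E u x + s\<^sup>2 * d
      + V x * ((u x + s)\<^sup>2 - (u x)\<^sup>2) - (square_log (u x + s) - square_log (u x))" for s
    using vsum_update[of x "\<lambda>y. V y * (?w s y)\<^sup>2" "\<lambda>y. V y * (u y)\<^sup>2"] potential_summable[OF u2]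
      vsum_update[of x "\<lambda>y. square_log (?w s y)" "\<lambda>y. square_log (u y)"] ul
      vsum_grad_sq_update[OF u2, of x s] action_eq[OF w, of s] action_eq[OF u(1)] u(3)
    by (simp add: d_def algebra_simps)
  define g where "g = (\<lambda>s. ?c - 2 * s * laplacian E u x + s\<^sup>2 * d
      + V x * ((u x + s)\<^sup>2 - (u x)\<^sup>2) - (square_log (u x + s) - square_log (u x))
      + (1 + 2 * u x * s + s\<^sup>2) * ln (1 + 2 * u x * s + s\<^sup>2) - ?c * (1 + 2 * u x * s + s\<^sup>2))"
  have nonneg: "0 \<le> g s" for s
    using log_sobolev[OF w, of s] unfolding mass_w action_w g_def by simp
  have chain: "((\<lambda>s. square_log (u x + s)) has_real_derivative 2 * u x * ln ((u x)\<^sup>2) + 2 * u x) (at 0)"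
  proof -
    have "((\<lambda>s. u x + s) has_real_derivative 1) (at 0)"
      by (auto intro!: derivative_eq_intros)
    then show ?thesis using DERIV_chain2[OF DERIV_square_log] by fastforce
  qed
  have "(g has_real_derivative - 2 * laplacian E u x + V x * (2 * u x)
      - (2 * u x * ln ((u x)\<^sup>2) + 2 * u x) + 2 * u x - ?c * (2 * u x)) (at 0)"
    unfolding g_def by (auto intro!: derivative_eq_intros chain)
  moreover have "g 0 = 0" by (simp add: g_def)
  ultimately have "- 2 * laplacian E u x + V x * (2 * u x)
      - (2 * u x * ln ((u x)\<^sup>2) + 2 * u x) + 2 * u x - ?c * (2 * u x) = 0"
    using nonneg by (intro DERIV_local_min[of g _ 0 1]) auto
  then show ?thesis by (simp add: algebra_simps)
qed

text \<open>
  At a zero of \<open>u\<close> the equation reduces to \<open>laplacian E u x = 0\<close>; as \<open>u \<ge> 0\<close>, all neighbours are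
  zeros as well.
\<close>

lemma minimizer_positive:
  assumes min: "minimizer E V u" and nonneg: "\<And>x. 0 \<le> u x"
  shows "0 < u x"
proof (rule ccontr)
  assume "\<not> 0 < u x"
  then have "u x = 0" using nonneg[of x] by linarith
  have step: "u z = 0" if "u y = 0" "E y z" for y z
  proof -
    have "(\<Sum>z | E y z. u z) = 0"
      using minimizer_euler_lagrange[OF min, of y] that(1) by (simp add: laplacian_def)
    then show ?thesis
      using nonneg fin that(2) by (simp add: sum_nonneg_eq_0_iff)
  qed
  have "u y = 0" for y
    using conn[of x y] by (induction rule: rtranclp_induct) (use \<open>u x = 0\<close> step in auto)
  then show False using min by (simp add: minimizer_def mass_def)
qed

end

section \<open>Energy, Nehari manifold and ground states\<close>

lemma vint_eq_vsum:
  assumes "vsummable f" shows "vint f = ereal (vsum f)"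
proof -
  have "(\<integral>\<^sup>+x. ennreal (f x) \<partial>count_space UNIV) \<noteq> \<infinity>" "(\<integral>\<^sup>+x. ennreal (- f x) \<partial>count_space UNIV) \<noteq> \<infinity>"
    using assms by (auto simp: real_integrable_def)
  then obtain a b where ab: "0 \<le> a" "0 \<le> b" "(\<integral>\<^sup>+x. ennreal (f x) \<partial>count_space UNIV) = ennreal a"
    "(\<integral>\<^sup>+x. ennreal (- f x) \<partial>count_space UNIV) = ennreal b"
    by (metis ennreal_cases infinity_ennreal_def)
  then show ?thesis
    unfolding vint_def using real_lebesgue_integral_def[OF assms] by (simp add: enn2ereal_ennreal)
qed

context bounded_schroedinger
begin

text \<open>
  Bounded degree makes the \<open>H\<^sup>1\<close> norm equivalent to the \<open>\<ell>\<^sup>2\<close> norm, and cutoffs at balls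
  approximate any \<open>\<ell>\<^sup>2\<close> function.
\<close>

lemma H1_eq_square_summable: "H1 E = {u. vsummable (\<lambda>x. (u x)\<^sup>2)}"
proof (intro equalityI subsetI CollectI)
  fix u assume "u \<in> H1 E"
  then have "vsummable (\<lambda>x. grad_sq E u x + (u x)\<^sup>2)" by (simp add: H1_def)
  then show "vsummable (\<lambda>x. (u x)\<^sup>2)"
    by (rule vsummable_bound) (simp add: grad_sq_nonneg)
next
  fix u :: "'a \<Rightarrow> real" assume "u \<in> {u. vsummable (\<lambda>x. (u x)\<^sup>2)}"
  then have u2: "vsummable (\<lambda>x. (u x)\<^sup>2)" by simp
  let ?r = "\<lambda>k x. cutoff (graph_ball k) u x - u x"
  have r: "?r k = (\<lambda>x. - 1 * cutoff (- graph_ball k) u x)" for k by (auto simp: cutoff_def)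
  have "(\<lambda>k. vsum (\<lambda>x. grad_sq E (?r k) x + (?r k x)\<^sup>2)) \<longlonglongrightarrow> vsum (\<lambda>x :: 'a. 0)"
  proof (rule vsum_tendsto_dominated)
    show "vsummable (\<lambda>x. nbr_mass u x + (u x)\<^sup>2)" using nbr_mass_summable[OF u2] u2 by simp
    show "\<bar>grad_sq E (?r k) x + (?r k x)\<^sup>2\<bar> \<le> nbr_mass u x + (u x)\<^sup>2" for k x
    proof -
      have "grad_sq E (?r k) x \<le> nbr_mass u x"
        using order_trans[OF grad_sq_le_nbr_mass nbr_mass_cutoff_le, of "- graph_ball k" u x]
        unfolding r grad_sq_scale by simp
      moreover have "(?r k x)\<^sup>2 \<le> (u x)\<^sup>2" by (auto simp: cutoff_def)
      ultimately show ?thesis by (simp add: grad_sq_nonneg)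
    qed
    have "(\<lambda>k. ?r k x) \<longlonglongrightarrow> 0" for x
      using tendsto_diff[OF cutoff_ball_tendsto tendsto_const, of u x "u x"] by simp
    then have "(\<lambda>k. grad_sq E (?r k) x + (?r k x)\<^sup>2) \<longlonglongrightarrow> grad_sq E (\<lambda>x. 0) x + 0\<^sup>2" for x
      by (intro tendsto_intros tendsto_grad_sq)
    then show "(\<lambda>k. grad_sq E (?r k) x + (?r k x)\<^sup>2) \<longlonglongrightarrow> 0" for x
      by (simp add: grad_sq_def)
  qed
  then have "(\<lambda>k. H1_norm E (?r k)) \<longlonglongrightarrow> 0"
    using tendsto_real_sqrt by (fastforce simp: H1_norm_def)
  moreover have "finite {x. cutoff (graph_ball k) u x \<noteq> 0}" for k
    by (rule finite_subset[OF _ finite_graph_ball[of k]]) (auto simp: cutoff_def)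
  ultimately show "u \<in> H1 E"
    unfolding H1_def using grad_sq_summable[OF u2] u2
    by (auto intro!: exI[of _ "\<lambda>k. cutoff (graph_ball k) u"])
qed

lemma energy_eq:
  assumes "u \<in> log_domain" shows "energy E V u = ereal ((action E V u + mass u) / 2)"
proof -
  have s: "vsummable (\<lambda>x. (u x)\<^sup>2)" "vsummable (\<lambda>x. square_log (u x))"
    using assms by (auto simp: log_domain_def)
  have "vsummable (\<lambda>x. grad_sq E u x + (V x + 1) * (u x)\<^sup>2)"
    "vsum (\<lambda>x. grad_sq E u x + (V x + 1) * (u x)\<^sup>2)
      = vsum (grad_sq E u) + vsum (\<lambda>x. V x * (u x)\<^sup>2) + mass u"
    using s grad_sq_summable[OF s(1)] potential_summable[OF s(1)]
    by (simp_all add: distrib_right mass_def)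
  then show ?thesis
    using s(2) by (simp add: energy_def vint_eq_vsum action_eq[OF assms] flip: square_log_def)
qed

text \<open>
  The positive part of \<open>u\<^sup>2 ln u\<^sup>2\<close> is summable for any \<open>u \<in> \<ell>\<^sup>2\<close> because \<open>u\<^sup>2 \<le> mass u\<close>. So finite energy
  means exactly that the negative part is summable as well.
\<close>

lemma energy_domain_eq: "energy_domain E V = log_domain"
proof (intro equalityI subsetI)
  fix u assume u: "u \<in> energy_domain E V"
  then have u2: "vsummable (\<lambda>x. (u x)\<^sup>2)"
    by (simp add: energy_domain_def X_space_def H1_eq_square_summable)
  let ?P = "\<integral>\<^sup>+x. ennreal (square_log (u x)) \<partial>count_space UNIV"
  let ?N = "\<integral>\<^sup>+x. ennreal (- square_log (u x)) \<partial>count_space UNIV"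
  have "square_log (u x) \<le> \<bar>ln (mass u)\<bar> * (u x)\<^sup>2" for x
  proof (cases "u x = 0")
    case False
    then have "ln ((u x)\<^sup>2) \<le> ln (mass u)"
      using power2_le_mass[OF u2] mass_pos[OF u2 False] by simp
    then have "ln ((u x)\<^sup>2) \<le> \<bar>ln (mass u)\<bar>" by linarith
    then have "(u x)\<^sup>2 * ln ((u x)\<^sup>2) \<le> (u x)\<^sup>2 * \<bar>ln (mass u)\<bar>"
      by (rule mult_left_mono) simp
    then show ?thesis by (simp add: square_log_def mult.commute)
  qed simp
  then have "?P \<le> (\<integral>\<^sup>+x. ennreal (\<bar>ln (mass u)\<bar> * (u x)\<^sup>2) \<partial>count_space UNIV)"
    by (intro nn_integral_mono ennreal_leI)
  also have "\<dots> < \<infinity>"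
  proof -
    have "vsummable (\<lambda>x. \<bar>ln (mass u)\<bar> * (u x)\<^sup>2)" using u2 by simp
    then show ?thesis by (simp only: real_integrable_def infinity_ennreal_def less_top)
  qed
  finally have P: "?P < \<infinity>" .
  have N: "?N \<noteq> \<infinity>"
  proof
    assume "?N = \<infinity>"
    moreover obtain p where "?P = ennreal p" "0 \<le> p"
      using P by (metis ennreal_cases infinity_ennreal_def less_irrefl)
    ultimately have "vint (\<lambda>x. (u x)\<^sup>2 * ln ((u x)\<^sup>2)) = - \<infinity>"
      by (simp add: vint_def enn2ereal_ennreal flip: square_log_def)
    moreover have "vsummable (\<lambda>x. grad_sq E u x + (V x + 1) * (u x)\<^sup>2)"
      using u2 grad_sq_summable[OF u2] potential_summable[OF u2] by (simp add: distrib_right)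
    ultimately have "energy E V u = \<infinity>"
      by (simp add: energy_def vint_eq_vsum)
    then show False using u by (simp add: energy_domain_def)
  qed
  show "u \<in> log_domain"
    using u2 P N by (auto simp: log_domain_def real_integrable_def)
next
  fix u :: "'a \<Rightarrow> real" assume u: "u \<in> log_domain"
  then have u2: "vsummable (\<lambda>x. (u x)\<^sup>2)" by (simp add: log_domain_def)
  then have "vsummable (\<lambda>x. (V x + 1) * (u x)\<^sup>2)"
    using potential_summable[OF u2] by (simp add: distrib_right)
  then show "u \<in> energy_domain E V"
    using u2 energy_eq[OF u] by (simp add: energy_domain_def X_space_def H1_eq_square_summable vint_eq_vsum)
qed

lemma nehari_eq: "nehari E V = {w \<in> log_domain. w \<noteq> (\<lambda>x. 0) \<and> action E V w = 0}"
proof -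
  have "vint (\<lambda>x. grad_sq E w x + V x * (w x)\<^sup>2) = vint (\<lambda>x. (w x)\<^sup>2 * ln ((w x)\<^sup>2)) \<longleftrightarrow> action E V w = 0"
    if "w \<in> log_domain" for w
  proof -
    have s: "vsummable (\<lambda>x. (w x)\<^sup>2)" "vsummable (\<lambda>x. square_log (w x))"
      using that by (auto simp: log_domain_def)
    then show ?thesis
      using grad_sq_summable[OF s(1)] potential_summable[OF s(1)]
      by (simp add: vint_eq_vsum action_eq[OF that] flip: square_log_def)
  qed
  then show ?thesis by (auto simp: nehari_def energy_domain_eq)
qed

text \<open>
  The factor \<open>exp (c/2)\<close>, with \<open>c\<close> the ground level, is the one that moves \<open>u\<close> onto the Nehari manifold;
  it also turns the multiplier \<open>c\<close> of the Euler-Lagrange equation into the logarithm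
  of the scaling. On the Nehari manifold the energy is half the mass, and there \<open>log_sobolev\<close> reads
  \<open>mass w \<ge> exp c\<close>.
\<close>

lemma ground_state_of_minimizer:
  assumes "minimizer E V u"
  shows "ground_state_solution E V (\<lambda>x. exp (ground_level E V / 2) * u x)"
proof -
  let ?c = "ground_level E V" and ?v = "\<lambda>x. exp (ground_level E V / 2) * u x"
  have u: "u \<in> log_domain" "mass u = 1" "action E V u = ?c"
    using assms by (auto simp: minimizer_def)
  have e2: "(exp (?c / 2))\<^sup>2 = exp ?c" by (simp add: exp_double[symmetric])
  have v: "?v \<in> log_domain" "mass ?v = exp ?c" "action E V ?v = 0"
    using scale_in_log_domain[OF u(1)] action_scale[OF u(1), of "exp (?c / 2)"] u(2,3)
    by (simp_all add: mass_scale e2)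
  have nonzero: "?v \<noteq> (\<lambda>x. 0)"
  proof
    assume "?v = (\<lambda>x. 0)"
    then have "mass ?v = 0" by (simp add: mass_def)
    then show False using v(2) by simp
  qed
  have "- laplacian E ?v x + V x * ?v x = ?v x * ln ((?v x)\<^sup>2)" for x
  proof (cases "u x = 0")
    case True
    then show ?thesis
      using minimizer_euler_lagrange[OF assms, of x]
      by (simp add: laplacian_def sum_distrib_left[symmetric])
  next
    case False
    then have "ln ((?v x)\<^sup>2) = ?c + ln ((u x)\<^sup>2)"
      by (simp add: power_mult_distrib e2 ln_mult)
    moreover have "laplacian E ?v x = exp (?c / 2) * laplacian E u x"
      by (simp add: laplacian_def sum_distrib_left right_diff_distrib)
    moreover have "V x * u x - laplacian E u x = u x * (?c + ln ((u x)\<^sup>2))"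
      using minimizer_euler_lagrange[OF assms, of x] by (simp add: algebra_simps)
    then have "exp (?c / 2) * (V x * u x - laplacian E u x) = exp (?c / 2) * (u x * (?c + ln ((u x)\<^sup>2)))"
      by simp
    ultimately show ?thesis by (simp add: algebra_simps)
  qed
  moreover have "energy E V ?v = (INF w\<in>nehari E V. energy E V w)"
  proof (rule antisym)
    show "energy E V ?v \<le> (INF w\<in>nehari E V. energy E V w)"
    proof (rule INF_greatest)
      fix w assume "w \<in> nehari E V"
      then have w: "w \<in> log_domain" "w \<noteq> (\<lambda>x. 0)" "action E V w = 0" by (auto simp: nehari_eq)
      then have m: "0 < mass w" using mass_pos[of w] by (auto simp: log_domain_def)
      have "mass w * (?c - ln (mass w)) \<le> 0"
        using log_sobolev[OF w(1)] w(3) by (simp add: algebra_simps)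
      then have "?c \<le> ln (mass w)" using m by (simp add: mult_le_0_iff)
      then have "exp ?c \<le> mass w" using m by (simp add: ln_ge_iff)
      then show "energy E V ?v \<le> energy E V w"
        by (simp add: energy_eq v w)
    qed
    show "(INF w\<in>nehari E V. energy E V w) \<le> energy E V ?v"
      using v nonzero by (intro INF_lower) (simp add: nehari_eq)
  qed
  ultimately show ?thesis
    using v(1) nonzero by (simp add: ground_state_solution_def solution_def energy_domain_eq)
qed

end

section \<open>Ground states on quasi-transitive graphs\<close>

lemma finite_orbits_representatives:
  assumes "subgroup \<Gamma> (Aut E)" and "finitely_many_orbits E \<Gamma>"
  obtains R where "finite R" "\<And>x. \<exists>r\<in>R. \<exists>\<gamma>\<in>\<Gamma>. \<gamma> r = x"
proof -
  define orb where "orb = orbit (Aut E\<lparr>carrier := \<Gamma>\<rparr>) (\<lambda>\<gamma>. \<gamma>)"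
  have orb: "orb x = {\<gamma> x | \<gamma>. \<gamma> \<in> \<Gamma>}" for x
    by (simp add: orb_def orbit_def)
  have fin: "finite (range orb)"
    using assms(2) by (simp add: finitely_many_orbits_def orbits_def orb_def full_SetCompr_eq)
  have "(\<lambda>x. x) \<in> \<Gamma>"
    using subgroup.one_closed[OF assms(1)] by (simp add: Aut_def BijGroup_def restrict_def)
  then have self: "x \<in> orb x" for x
    unfolding orb by (auto intro!: exI[of _ "\<lambda>x. x"])
  let ?R = "inv_into UNIV orb ` range orb"
  have "\<exists>r\<in>?R. \<exists>\<gamma>\<in>\<Gamma>. \<gamma> r = x" for x
  proof -
    define r where "r = inv_into UNIV orb (orb x)"
    have "orb r = orb x" by (simp add: r_def f_inv_into_f)
    then have "x \<in> orb r" using self by simp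
    then have "\<exists>\<gamma>\<in>\<Gamma>. \<gamma> r = x" using orb[of r] by auto
    moreover have "r \<in> ?R" by (simp add: r_def)
    ultimately show ?thesis by blast
  qed
  then show ?thesis using fin that[of ?R] by blast
qed

lemma subgroup_AutD:
  assumes "subgroup \<Gamma> (Aut E)" "\<gamma> \<in> \<Gamma>"
  shows "bij \<gamma>" and "E (\<gamma> x) (\<gamma> y) \<longleftrightarrow> E x y"
  using subgroup.subset[OF assms(1)] assms(2) by (auto simp: Aut_def Bij_def)

theorem theorem1p5:
  fixes E :: "'a \<Rightarrow> 'a \<Rightarrow> bool" and \<Gamma> :: "('a \<Rightarrow> 'a) set" and V :: "'a \<Rightarrow> real" and x0 :: 'a
  assumes "symp E" and "connected_graph E" and "locally_finite_graph E" and "quasi_transitive E"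
    and "subgroup \<Gamma> (Aut E)" and "finitely_many_orbits E \<Gamma>"
    and "(INF x. ereal (V x)) > -1"
    and "invariant_under \<Gamma> V
      \<or> (\<exists>V\<^sub>p :: 'a \<Rightarrow> real. invariant_under \<Gamma> V\<^sub>p \<and> (\<forall>x. V x \<le> V\<^sub>p x) \<and>
           ((\<lambda>x. \<bar>V x - V\<^sub>p x\<bar>) \<longlongrightarrow> 0) (at_graph_infinity E x0))
      \<or> (\<exists>V_inf :: real. (SUP x. ereal (V x)) = ereal V_inf \<and>
           (V \<longlongrightarrow> V_inf) (at_graph_infinity E x0))"
  shows "\<exists>u :: 'a \<Rightarrow> real. ground_state_solution E V u \<and> ((\<forall>x. u x > 0) \<or> (\<forall>x. u x < 0))"
proof -
  obtain W where W: "invariant_under \<Gamma> W" "\<And>x. V x \<le> W x"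
    "((\<lambda>x. \<bar>V x - W x\<bar>) \<longlongrightarrow> 0) (at_graph_infinity E x0)"
  proof -
    consider (a) "invariant_under \<Gamma> V"
      | (b) W where "invariant_under \<Gamma> W" "\<And>x. V x \<le> W x"
        "((\<lambda>x. \<bar>V x - W x\<bar>) \<longlongrightarrow> 0) (at_graph_infinity E x0)"
      | (c) V_inf where "(SUP x. ereal (V x)) = ereal V_inf" "(V \<longlongrightarrow> V_inf) (at_graph_infinity E x0)"
      using assms(8) by blast
    then show ?thesis
    proof cases
      case a then show ?thesis using that[of V] by simp
    next
      case b then show ?thesis by (rule that)
    next
      case c
      have "V x \<le> V_inf" for x
        using SUP_upper[of x UNIV "\<lambda>x. ereal (V x)"] c(1) by simp
      moreover have "((\<lambda>x. \<bar>V x - V_inf\<bar>) \<longlongrightarrow> 0) (at_graph_infinity E x0)"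
        by (rule tendsto_rabs_zero[OF LIM_zero[OF c(2)]])
      ultimately show ?thesis using that[of "\<lambda>_. V_inf"] by (simp add: invariant_under_def)
    qed
  qed
  note \<Gamma> = subgroup_AutD[OF assms(5)]
  have W_inv: "W (\<gamma> x) = W x" if "\<gamma> \<in> \<Gamma>" for \<gamma> x
    using W(1) that by (simp add: invariant_under_def)
  obtain R where R: "finite R" "\<And>x. \<exists>r\<in>R. \<exists>\<gamma>\<in>\<Gamma>. \<gamma> r = x"
    using finite_orbits_representatives[OF assms(5,6)] by blast
  define D where "D = (\<Sum>r\<in>R. card {y. E r y})"
  \<comment> \<open>The summand \<open>1\<close> accounts for the lower bound \<open>V > - 1\<close>.\<close>
  define K where "K = 1 + (\<Sum>r\<in>R. \<bar>W r\<bar>)"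
  have deg: "card {y. E x y} \<le> D" for x
  proof -
    obtain r \<gamma> where r: "r \<in> R" "\<gamma> \<in> \<Gamma>" "\<gamma> r = x" using R(2) by blast
    have "{y. E x y} = \<gamma> ` {y. E r y}"
      using nbrs_automorphism[of \<gamma> E r] \<Gamma>[OF r(2)] r(3) by simp
    then have "card {y. E x y} = card {y. E r y}"
      using \<Gamma>(1)[OF r(2)] by (simp add: card_image bij_def inj_on_def)
    also have "\<dots> \<le> D"
      unfolding D_def using r(1) R(1) by (intro member_le_sum) auto
    finally show ?thesis .
  qed
  have W_bound: "\<bar>W x\<bar> \<le> K" for x
  proof -
    obtain r \<gamma> where r: "r \<in> R" "\<gamma> \<in> \<Gamma>" "\<gamma> r = x" using R(2) by blast
    have "\<bar>W x\<bar> = \<bar>W r\<bar>" using W_inv[OF r(2), of r] r(3) by simp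
    also have "\<dots> \<le> (\<Sum>r\<in>R. \<bar>W r\<bar>)"
      using r(1) R(1) member_le_sum[of r R "\<lambda>r. \<bar>W r\<bar>"] by simp
    finally show ?thesis by (simp add: K_def)
  qed
  have V_bound: "\<bar>V x\<bar> \<le> K" for x
  proof -
    have "- 1 < ereal (V x)"
      using assms(7) INF_lower[of x UNIV "\<lambda>x. ereal (V x)"] by (auto intro: less_le_trans)
    then have "- 1 < V x" by (simp add: one_ereal_def)
    moreover have "1 \<le> K" unfolding K_def by (simp add: sum_nonneg)
    ultimately show ?thesis using W(2)[of x] W_bound[of x] by linarith
  qed
  interpret W: bounded_schroedinger E x0 D W K
    using assms(1-3) deg W_bound
    by unfold_locales (auto simp: connected_graph_def locally_finite_graph_def dest: sympD)
  interpret V: bounded_schroedinger E x0 D V K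
    using V_bound by unfold_locales auto
  have cocompact: "\<exists>p. minimizer E W p"
    by (rule W.minimizer_if_cocompact[of R \<Gamma>]) (use R \<Gamma> W_inv in auto)
  have "\<exists>u. minimizer E V u"
  proof (cases "\<exists>z. V z < W z")
    case True
    then obtain z where z: "V z < W z" ..
    obtain p where "minimizer E W p" using cocompact ..
    then have p: "minimizer E W (\<lambda>x. \<bar>p x\<bar>)" by (rule W.minimizer_abs)
    then have "0 < \<bar>p z\<bar>" using W.minimizer_positive[OF p] by simp
    then show ?thesis
      using V.minimizer_if_below[OF W.bounded_schroedinger_axioms W(2) z W(3) p] by simp
  next
    case False
    then have "V = W" using W(2) by (intro ext antisym) (auto simp: not_less)
    then show ?thesis using cocompact by simp
  qed
  then obtain u where "minimizer E V u" ..
  then have u: "minimizer E V (\<lambda>x. \<bar>u x\<bar>)" by (rule V.minimizer_abs)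
  then have "0 < \<bar>u x\<bar>" for x using V.minimizer_positive[OF u] by simp
  then show ?thesis
    using V.ground_state_of_minimizer[OF u] by (intro exI conjI disjI1) auto
qed

end
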